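(* Let $n\ge 3$ and let $M\subset SF(n+1,k,a)$ be a connected hypersurface with constant mean curvature $H$ and two principal curvatures $\lambda$ (multiplicity $n-1$) and $\mu$ (multiplicity $1$), oriented so that $\lambda-\mu>0$, with $w,\eta,Z$ as in the context. Then: (i) $w\,e_n(\lambda)+\lambda\,e_n(w)=\mu\,e_n(w)$, equivalently $-\frac{e_n(w)}{w}=\frac{e_n(\lambda)}{\lambda-\mu}$; (ii) $\bar\nabla_v e_n=\frac{e_n(w)}{w}\,v$ for every $v\in\Gamma$; (iii) $e_n(e_n(w))=-ad\,w-bd\,w\lambda\mu$; (iv) there is a constant $C\in\mathbb{R}$ with $(e_n(w))^2+d\,w^2(a+b\lambda^2)=C$ on all of $M$; (v) $\bar\nabla_{e_n}x=e_n$, $\bar\nabla_{e_n}\nu=-\mu e_n$ and $\bar\nabla_{e_n}e_n=bd\mu\,\nu-ad\,x$; (vi) $\bar\nabla_{e_n}\eta=0$; (vii) $\bar\nabla_v\eta=-\frac{C}{w}\,v$ for every $v\in\Gamma$; (viii) $\langle\eta,\eta\rangle=dC$; (ix) if $a=0$, then the vector field $Z$ is constant on $M$.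
   Context: For integers $0\le j<m$, $\mathbb{R}^m_j$ denotes $\mathbb{R}^m$ with the bilinear form $\langle v,w\rangle=-\sum_{i=1}^{j}v_iw_i+\sum_{i=j+1}^{m}v_iw_i$. For $a\in\{-1,0,1\}$: $SF(n+1,k,1)=\{x\in\mathbb{R}^{n+2}_k:\langle x,x\rangle=1\}$, $SF(n+1,k,-1)=\{x\in\mathbb{R}^{n+2}_{k+1}:\langle x,x\rangle=-1\}$, $SF(n+1,k,0)=\mathbb{R}^{n+1}_k$, with the induced (semi-)Riemannian metric. $\bar\nabla$ is the flat derivative of the ambient vector space ($\mathbb{R}^{n+2}$ if $a=\pm1$, $\mathbb{R}^{n+1}$ if $a=0$); $x$ denotes the position vector of a point of $M$. A hypersurface $M$ (image of an immersion of a connected $n$-manifold) has two principal curvatures $\lambda$ (multiplicity $n-1$) and $\mu$ (multiplicity $1$) if: there is a smooth global Gauss map $\nu$ ($\nu(x)$ tangent to $SF(n+1,k,a)$, orthogonal to $T_xM$, $\langle\nu,\nu\rangle=b\in\{\pm1\}$ constant); smooth $\lambda,\mu:M\to\mathbb{R}$ with $\lambda\neq\mu$ everywhere; a global vector field $e_n$ with $\langle e_n,e_n\rangle=d\in\{\pm1\}$; and locally a frame $e_1,\dots,e_n$ with $|\langle e_i,e_j\rangle|=\delta_{ij}$, $A e_i=\lambda e_i$ ($i<n$), $Ae_n=\mu e_n$, where $A(v)=-\bar\nabla_v\nu$. $\Gamma(x)=\{v\in T_xM:A(v)=\lambda v\}$. Constant mean curvature $H$: $(n-1)\lambda+\mu=nH$,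 $H$ constant. Definitions: $w=(\lambda-H)^{-1/n}=\left(\frac{\lambda-\mu}{n}\right)^{-1/n}$ (positive since $\lambda>\mu$); $\eta=-e_n(w)\,e_n+db\lambda w\,\nu-da\,w\,x$; $Z=\lambda w\,e_n+e_n(w)\,\nu$; here $e_n(w)$ is the derivative of $w$ in direction $e_n$. The constant $C$ in (iv) is called the constant associated with $M$. *)

theory Defs
  imports "HOL-Analysis.Analysis"
begin

text \<open>Semi-Euclidean bilinear form of index j on real^'N: the first j coordinates
  (w.r.t. the linear order of the index type) carry a minus sign.\<close>
definition sform :: "nat \<Rightarrow> (real,'N::{finite,linorder}) vec \<Rightarrow> (real,'N) vec \<Rightarrow> real" where
  "sform j v w = (\<Sum>i\<in>UNIV. (if card {l. l < i} < j then -1 else 1) * (v$i) * (w$i))"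

text \<open>Smoothness (C-infinity) on an open set: all iterated directional derivatives exist.\<close>
definition smooth_on :: "'a::real_normed_vector set \<Rightarrow> ('a \<Rightarrow> 'b::real_normed_vector) \<Rightarrow> bool" where
  "smooth_on S f \<longleftrightarrow>
     (\<exists>F. f \<in> F \<and> (\<forall>g\<in>F. \<forall>x\<in>S. g differentiable (at x)) \<and>
          (\<forall>g\<in>F. \<forall>v. \<exists>h\<in>F. \<forall>x\<in>S. h x = frechet_derivative g (at x) v))"

definition smooth_atlas :: "((real^'n) set \<times> (real^'n \<Rightarrow> 'm::topological_space)) set \<Rightarrow> bool" where
  "smooth_atlas A \<longleftrightarrow>
     (\<forall>(U,\<psi>)\<in>A. open U \<and> open (\<psi> ` U) \<and> (\<exists>g. homeomorphism U (\<psi> ` U) \<psi> g)) \<and>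
     (\<forall>p. \<exists>(U,\<psi>)\<in>A. p \<in> \<psi> ` U) \<and>
     (\<forall>(U1,\<psi>1)\<in>A. \<forall>(U2,\<psi>2)\<in>A.
        smooth_on (U1 \<inter> \<psi>1 -` (\<psi>2 ` U2)) (inv_into U2 \<psi>2 \<circ> \<psi>1))"

definition mfd_smooth :: "((real^'n) set \<times> (real^'n \<Rightarrow> 'm)) set \<Rightarrow> ('m \<Rightarrow> 'b::real_normed_vector) \<Rightarrow> bool" where
  "mfd_smooth A g \<longleftrightarrow> (\<forall>(U,\<psi>)\<in>A. smooth_on U (g \<circ> \<psi>))"

definition immersion :: "((real^'n) set \<times> (real^'n \<Rightarrow> 'm)) set \<Rightarrow> ('m \<Rightarrow> real^'N::finite) \<Rightarrow> bool" where
  "immersion A f \<longleftrightarrow> mfd_smooth A f \<and>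
     (\<forall>(U,\<psi>)\<in>A. \<forall>u\<in>U. inj (frechet_derivative (f \<circ> \<psi>) (at u)))"

definition tspace :: "((real^'n) set \<times> (real^'n \<Rightarrow> 'm)) set \<Rightarrow> ('m \<Rightarrow> real^'N::finite) \<Rightarrow> 'm \<Rightarrow> (real^'N) set" where
  "tspace A f p = {v. \<exists>U \<psi> u h. (U,\<psi>) \<in> A \<and> u \<in> U \<and> \<psi> u = p \<and>
                        frechet_derivative (f \<circ> \<psi>) (at u) h = v}"

text \<open>Derivative of a map g on M in the direction of the tangent vector v at p
  (this is the flat derivative for vector valued maps, v(g) for scalar maps).\<close>
definition deriv_along :: "((real^'n) set \<times> (real^'n \<Rightarrow> 'm)) set \<Rightarrow> ('m \<Rightarrow> real^'N::finite)
    \<Rightarrow> ('m \<Rightarrow> 'b::real_normed_vector) \<Rightarrow> 'm \<Rightarrow> real^'N \<Rightarrow> 'b" where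
  "deriv_along A f g p v = (SOME y. \<exists>U \<psi> u h. (U,\<psi>) \<in> A \<and> u \<in> U \<and> \<psi> u = p \<and>
        frechet_derivative (f \<circ> \<psi>) (at u) h = v \<and> y = frechet_derivative (g \<circ> \<psi>) (at u) h)"

end

theory Submission
  imports Defs
begin

text \<open>In a chart, write \<open>X\<close>, \<open>N\<close>, \<open>e\<close> for the position vector, the Gauss map and \<open>e\<^sub>n\<close>. The two
  curvatures turn the shape operator into \<open>dN = - \<lambda> dX + d (\<lambda> - \<mu>) \<langle>dX, e\<rangle> e\<close>. Differentiating
  once more and using symmetry of second derivatives gives the Codazzi equation: for
  \<open>n \<ge> 3\<close> it forces \<open>\<lambda>\<close> to be constant along \<open>\<Gamma>\<close>, and then
  \<open>de = g dX + d \<langle>dX, e\<rangle> (b d \<mu> N - a d X - g e)\<close> with \<open>g = - e\<^sub>n(\<lambda>) / (\<lambda> - \<mu>) = e\<^sub>n(w) / w\<close>. This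
  equation has the same shape, and the same symmetry argument yields
  \<open>dg = 0\<close> on \<open>\<Gamma>\<close> and \<open>e\<^sub>n(g) = - b d \<lambda> \<mu> - a d - g\<^sup>2\<close>. All claims follow by differentiating the
  defining expressions; constancy of \<open>C\<close> and \<open>Z\<close> uses connectedness.\<close>

subsection \<open>Second derivatives and orthogonal frames\<close>

text \<open>The mean value theorem along \<open>h\<close>, applied to the increment in direction
  \<open>k\<close>, turns the second difference into a difference of first derivatives at two nearby
  points. The derivative \<open>G\<close> at the single point \<open>x\<close> then evaluates it up
  to an error small against \<open>t\<^sup>2\<close>.\<close>

lemma second_difference_approx:
  fixes f :: "'a::real_normed_vector \<Rightarrow> real"
  assumes S: "open S" "x \<in> S" and f': "\<And>y. y \<in> S \<Longrightarrow> (f has_derivative f' y) (at y)"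
    and G: "((\<lambda>y. f' y h) has_derivative G) (at x)" and "e > 0"
  shows "\<exists>\<delta>>0. \<forall>t. 0 < t \<and> t < \<delta> \<longrightarrow>
    \<bar>f (x + t *\<^sub>R h + t *\<^sub>R k) - f (x + t *\<^sub>R h) - f (x + t *\<^sub>R k) + f x - t\<^sup>2 * G k\<bar> \<le> e * t\<^sup>2"
proof -
  define m where "m = norm h + norm k + 1"
  have m: "m > 0" unfolding m_def by (smt (verit) norm_ge_zero)
  \<comment> \<open>Two errors of size \<open>e' * (t * m)\<close> will be added;
    \<open>t * m\<close> bounds the distance from \<open>x\<close> to the points of the
    parallelogram spanned by \<open>t *\<^sub>R h\<close> and \<open>t *\<^sub>R k\<close>.\<close>
  define e' where "e' = e / (2 * m)"
  have e': "e' > 0" using \<open>e > 0\<close> m by (simp add: e'_def)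
  obtain r where r: "r > 0" "ball x r \<subseteq> S" using S open_contains_ball by blast
  interpret G: bounded_linear G using G by (rule has_derivative_bounded_linear)
  obtain \<delta>1 where \<delta>1: "\<delta>1 > 0"
    "\<And>y. norm (y - x) < \<delta>1 \<Longrightarrow> norm (f' y h - f' x h - G (y - x)) \<le> e' * norm (y - x)"
    using G e' unfolding has_derivative_at_alt by blast
  define \<delta> where "\<delta> = min r \<delta>1 / m"
  have "\<delta> > 0" using r \<delta>1 m by (simp add: \<delta>_def)
  moreover have "\<bar>f (x + t *\<^sub>R h + t *\<^sub>R k) - f (x + t *\<^sub>R h) - f (x + t *\<^sub>R k) + f x - t\<^sup>2 * G k\<bar> \<le> e * t\<^sup>2"
    if t: "0 < t" "t < \<delta>" for t
  proof -
    have tm: "t * m < r" "t * m < \<delta>1"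
      using t m by (auto simp: \<delta>_def field_simps)
    have small: "norm (s *\<^sub>R h + c *\<^sub>R k) \<le> t * m" if "0 \<le> s" "s \<le> t" "0 \<le> c" "c \<le> t" for s c
    proof -
      have "norm (s *\<^sub>R h + c *\<^sub>R k) \<le> s * norm h + c * norm k"
        using norm_triangle_ineq[of "s *\<^sub>R h" "c *\<^sub>R k"] that by simp
      also have "\<dots> \<le> t * norm h + t * norm k"
        using that by (intro add_mono mult_right_mono) auto
      also have "\<dots> \<le> t * m" using t by (simp add: m_def algebra_simps)
      finally show ?thesis .
    qed
    have inS: "x + s *\<^sub>R h + c *\<^sub>R k \<in> S" if "0 \<le> s" "s \<le> t" "0 \<le> c" "c \<le> t" for s c
    proof -
      have "dist x (x + s *\<^sub>R h + c *\<^sub>R k) < r"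
        using small[OF that] tm norm_minus_cancel[of "s *\<^sub>R h + c *\<^sub>R k"]
        by (simp add: dist_norm diff_diff_eq[symmetric])
      then show ?thesis using r by auto
    qed
    define \<phi> where "\<phi> s = f (x + s *\<^sub>R h + t *\<^sub>R k) - f (x + s *\<^sub>R h)" for s
    have line: "((\<lambda>s. f (x + s *\<^sub>R h + c *\<^sub>R k)) has_real_derivative f' (x + s *\<^sub>R h + c *\<^sub>R k) h) (at s)"
      if "0 \<le> s" "s \<le> t" "0 \<le> c" "c \<le> t" for s c
    proof -
      have "((\<lambda>s. x + s *\<^sub>R h + c *\<^sub>R k) has_derivative (\<lambda>z. z *\<^sub>R h)) (at s)"
        by (auto intro!: derivative_eq_intros)
      from has_derivative_compose[OF this f'[OF inS[OF that]]]
      show ?thesis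
        unfolding has_field_derivative_def
        using linear_cmul[OF has_derivative_linear[OF f'[OF inS[OF that]]]]
        by (simp add: mult.commute[of _ "f' _ _"])
    qed
    have "\<exists>z>0. z < t \<and> \<phi> t - \<phi> 0 = (t - 0) * (f' (x + z *\<^sub>R h + t *\<^sub>R k) h - f' (x + z *\<^sub>R h) h)"
    proof (rule MVT2[OF \<open>0 < t\<close>])
      fix s assume s: "0 \<le> s" "s \<le> t"
      show "(\<phi> has_real_derivative f' (x + s *\<^sub>R h + t *\<^sub>R k) h - f' (x + s *\<^sub>R h) h) (at s)"
        unfolding \<phi>_def using line[OF s, of t] line[OF s, of 0] t
        by (auto intro!: derivative_eq_intros)
    qed
    then obtain z where z: "0 < z" "z < t"
      and mvt: "\<phi> t - \<phi> 0 = t * (f' (x + z *\<^sub>R h + t *\<^sub>R k) h - f' (x + z *\<^sub>R h) h)" by auto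
    have est: "\<bar>f' (x + z *\<^sub>R h + c *\<^sub>R k) h - f' x h - G (z *\<^sub>R h + c *\<^sub>R k)\<bar> \<le> e' * (t * m)"
      if "0 \<le> c" "c \<le> t" for c
    proof -
      have n: "norm (z *\<^sub>R h + c *\<^sub>R k) \<le> t * m" using small[of z c] z that by auto
      have "norm (f' (x + z *\<^sub>R h + c *\<^sub>R k) h - f' x h - G (z *\<^sub>R h + c *\<^sub>R k)) \<le> e' * norm (z *\<^sub>R h + c *\<^sub>R k)"
        using \<delta>1(2)[of "x + z *\<^sub>R h + c *\<^sub>R k"] n tm by (simp add: add.assoc)
      also have "\<dots> \<le> e' * (t * m)" using n e' by (intro mult_left_mono) auto
      finally show ?thesis by simp
    qed
    \<comment> \<open>The unknown \<open>z\<close> drops out: by linearity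
      \<open>G (z *\<^sub>R h + t *\<^sub>R k)\<close> and \<open>G (z *\<^sub>R h)\<close> differ
      by \<open>t * G k\<close>.\<close>
    have "\<bar>(f' (x + z *\<^sub>R h + t *\<^sub>R k) h - f' (x + z *\<^sub>R h) h) - t * G k\<bar> \<le> 2 * (e' * (t * m))"
      using est[of t] est[of 0] t by (simp add: G.add G.scaleR)
    also have "\<dots> = e * t" using m by (simp add: e'_def)
    finally have "t * \<bar>(f' (x + z *\<^sub>R h + t *\<^sub>R k) h - f' (x + z *\<^sub>R h) h) - t * G k\<bar> \<le> t * (e * t)"
      using t by (intro mult_left_mono) auto
    moreover have "t * \<bar>(f' (x + z *\<^sub>R h + t *\<^sub>R k) h - f' (x + z *\<^sub>R h) h) - t * G k\<bar>
        = \<bar>\<phi> t - \<phi> 0 - t\<^sup>2 * G k\<bar>"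
    proof -
      have "\<phi> t - \<phi> 0 - t\<^sup>2 * G k
          = t * ((f' (x + z *\<^sub>R h + t *\<^sub>R k) h - f' (x + z *\<^sub>R h) h) - t * G k)"
        unfolding mvt by (simp add: power2_eq_square right_diff_distrib)
      then show ?thesis using t by (simp only: abs_mult abs_of_pos)
    qed
    ultimately show ?thesis
      by (simp add: \<phi>_def power2_eq_square algebra_simps)
  qed
  ultimately show ?thesis by blast
qed

text \<open>The second difference is symmetric in \<open>h\<close> and \<open>k\<close>; divided by
  \<open>t\<^sup>2\<close> it tends both to \<open>Gh k\<close> and to \<open>Gk h\<close>.\<close>

lemma second_derivative_symmetric_real:
  fixes f :: "'a::real_normed_vector \<Rightarrow> real"
  assumes "open S" "x \<in> S" and f': "\<And>y. y \<in> S \<Longrightarrow> (f has_derivative f' y) (at y)"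
    and Gh: "((\<lambda>y. f' y h) has_derivative Gh) (at x)"
    and Gk: "((\<lambda>y. f' y k) has_derivative Gk) (at x)"
  shows "Gh k = Gk h"
proof -
  have "\<bar>Gh k - Gk h\<bar> \<le> e" if "e > 0" for e
  proof -
    have e2: "e / 2 > 0" using that by simp
    obtain \<delta>1 \<delta>2 where \<delta>: "\<delta>1 > 0" "\<delta>2 > 0" and
      1: "\<And>t. 0 < t \<Longrightarrow> t < \<delta>1 \<Longrightarrow> \<bar>f (x + t *\<^sub>R h + t *\<^sub>R k) - f (x + t *\<^sub>R h) - f (x + t *\<^sub>R k) + f x - t\<^sup>2 * Gh k\<bar> \<le> e/2 * t\<^sup>2" and
      2: "\<And>t. 0 < t \<Longrightarrow> t < \<delta>2 \<Longrightarrow> \<bar>f (x + t *\<^sub>R k + t *\<^sub>R h) - f (x + t *\<^sub>R k) - f (x + t *\<^sub>R h) + f x - t\<^sup>2 * Gk h\<bar> \<le> e/2 * t\<^sup>2"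
      using second_difference_approx[OF assms(1,2) f' Gh e2, of k]
        second_difference_approx[OF assms(1,2) f' Gk e2, of h] by metis
    define t where "t = min \<delta>1 \<delta>2 / 2"
    have t: "0 < t" "t < \<delta>1" "t < \<delta>2" using \<delta> by (auto simp: t_def)
    have eq: "x + t *\<^sub>R k + t *\<^sub>R h = x + t *\<^sub>R h + t *\<^sub>R k" by (simp add: algebra_simps)
    have "\<bar>t\<^sup>2 * Gh k - t\<^sup>2 * Gk h\<bar> \<le> e * t\<^sup>2"
      using 1[OF t(1,2)] 2[OF t(1,3)] unfolding eq by linarith
    moreover have "\<bar>t\<^sup>2 * Gh k - t\<^sup>2 * Gk h\<bar> = t\<^sup>2 * \<bar>Gh k - Gk h\<bar>"
      unfolding right_diff_distrib[symmetric] by (simp add: abs_mult)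
    ultimately have "t\<^sup>2 * \<bar>Gh k - Gk h\<bar> \<le> t\<^sup>2 * e"
      by (simp add: mult.commute)
    then show ?thesis using t by simp
  qed
  then show ?thesis
    by (metis abs_le_zero_iff diff_ge_0_iff_ge eq_iff_diff_eq_0 field_le_epsilon add_0)
qed

lemma second_derivative_symmetric:
  fixes f :: "'a::real_normed_vector \<Rightarrow> 'b::euclidean_space"
  assumes "open S" "x \<in> S" and f': "\<And>y. y \<in> S \<Longrightarrow> (f has_derivative f' y) (at y)"
    and Gh: "((\<lambda>y. f' y h) has_derivative Gh) (at x)"
    and Gk: "((\<lambda>y. f' y k) has_derivative Gk) (at x)"
  shows "Gh k = Gk h"
proof (rule euclidean_eqI)
  fix i :: 'b
  show "Gh k \<bullet> i = Gk h \<bullet> i"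
    by (rule second_derivative_symmetric_real[OF assms(1,2), where f = "\<lambda>y. f y \<bullet> i" and f' = "\<lambda>y v. f' y v \<bullet> i"])
      (use f' Gh Gk in \<open>auto intro!: derivative_intros\<close>)
qed

section \<open>Derivatives of smooth maps\<close>

abbreviation fderiv :: "('a::real_normed_vector \<Rightarrow> 'b::real_normed_vector) \<Rightarrow> 'a \<Rightarrow> 'a \<Rightarrow> 'b" where
  "fderiv f u \<equiv> frechet_derivative f (at u)"

lemma fderivI: "(f has_derivative f') (at u) \<Longrightarrow> fderiv f u = f'"
  by (metis frechet_derivative_at)

lemma fderiv_has: "f differentiable (at u) \<Longrightarrow> (f has_derivative fderiv f u) (at u)"
  by (simp add: frechet_derivative_works)

lemma smooth_on_differentiable: "smooth_on S f \<Longrightarrow> x \<in> S \<Longrightarrow> f differentiable (at x)"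
  unfolding smooth_on_def by blast

text \<open>\<open>smooth_on\<close> supplies a differentiable \<open>g\<close> that agrees with the
  directional derivative on \<open>S\<close> only; openness of \<open>S\<close> transfers
  differentiability.\<close>

lemma smooth_on_fderiv_differentiable:
  assumes "smooth_on S f" "open S" "x \<in> S"
  shows "(\<lambda>y. fderiv f y h) differentiable (at x)"
proof -
  obtain g where g: "\<And>y. y \<in> S \<Longrightarrow> g y = fderiv f y h" "g differentiable (at x)"
    using assms unfolding smooth_on_def by metis
  obtain D where "(g has_derivative D) (at x)" using g(2) unfolding differentiable_def by blast
  then have "((\<lambda>y. fderiv f y h) has_derivative D) (at x)"
    by (rule has_derivative_transform_within_open[OF _ assms(2,3)]) (rule g(1))
  then show ?thesis by (rule differentiableI)
qed

lemma smooth_on_second_fderiv_sym: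
  fixes f :: "'a::real_normed_vector \<Rightarrow> 'b::euclidean_space"
  assumes "smooth_on S f" "open S" "x \<in> S"
  shows "fderiv (\<lambda>y. fderiv f y h) x k = fderiv (\<lambda>y. fderiv f y k) x h"
  using second_derivative_symmetric[OF assms(2,3) fderiv_has[OF smooth_on_differentiable[OF assms(1)]]
    fderiv_has[OF smooth_on_fderiv_differentiable[OF assms]]
    fderiv_has[OF smooth_on_fderiv_differentiable[OF assms]]] .

text \<open>Nonzero squares replace definiteness: pairing a vanishing combination with
  \<open>s\<close> isolates the coefficient of \<open>s\<close>, so \<open>S\<close> is independent
  and, by its size, a basis.\<close>

lemma orthogonal_expansion:
  fixes B :: "'b::euclidean_space \<Rightarrow> 'b \<Rightarrow> real"
  assumes B: "bilinear B" and S: "finite S" "card S \<ge> DIM('b)"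
    and orth: "\<And>s t. s \<in> S \<Longrightarrow> t \<in> S \<Longrightarrow> s \<noteq> t \<Longrightarrow> B s t = 0"
    and nz: "\<And>s. s \<in> S \<Longrightarrow> B s s \<noteq> 0"
  shows "v = (\<Sum>s\<in>S. (B v s / B s s) *\<^sub>R s)"
proof -
  have lin: "linear (\<lambda>y. B y s)" for s using B by (simp add: bilinear_def)
  have coeff: "B (\<Sum>t\<in>S. c t *\<^sub>R t) s = c s * B s s" if "s \<in> S" for c s
  proof -
    have "B (\<Sum>t\<in>S. c t *\<^sub>R t) s = (\<Sum>t\<in>S. c t * B t s)"
      by (simp add: linear_sum[OF lin] linear_cmul[OF lin])
    also have "\<dots> = (\<Sum>t\<in>S. if t = s then c s * B s s else 0)"
      using orth that by (intro sum.cong) auto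
    finally show ?thesis using S that by simp
  qed
  have "independent S"
  proof (rule independent_if_scalars_zero[OF S(1)])
    fix c s assume "(\<Sum>t\<in>S. c t *\<^sub>R t) = 0" "s \<in> S"
    then show "c s = 0" using coeff[of s c] nz[of s] linear_0[OF lin] by simp
  qed
  then have "v \<in> span S"
    using card_ge_dim_independent[of S UNIV] S by auto
  then obtain c where v: "v = (\<Sum>s\<in>S. c s *\<^sub>R s)"
    using S by (auto simp: span_finite)
  show ?thesis
    by (subst v) (rule sum.cong, use coeff nz v in auto)
qed

lemma orthogonal_to_basis_zero:
  fixes B :: "'b::euclidean_space \<Rightarrow> 'b \<Rightarrow> real"
  assumes "bilinear B" "finite S" "card S \<ge> DIM('b)"
    and "\<And>s t. s \<in> S \<Longrightarrow> t \<in> S \<Longrightarrow> s \<noteq> t \<Longrightarrow> B s t = 0"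
    and "\<And>s. s \<in> S \<Longrightarrow> B s s \<noteq> 0"
    and "\<And>s. s \<in> S \<Longrightarrow> B v s = 0"
  shows "v = 0"
  using orthogonal_expansion[OF assms(1-5), of v] assms(6) by simp

subsection \<open>Structure equations in a chart\<close>

text \<open>Differentiate the equation for \<open>F\<close> in a second direction. Second
  derivatives of \<open>F\<close> and \<open>X\<close> are symmetric, so they cancel when the two
  directions are exchanged, and only first derivatives remain.\<close>

lemma symmetrized_structure_equation:
  fixes X F :: "'a::euclidean_space \<Rightarrow> 'b::euclidean_space" and B :: "'b \<Rightarrow> 'b \<Rightarrow> real"
  assumes bb: "bounded_bilinear B" and U: "open U" "u \<in> U"
    and X: "smooth_on U X" and F: "smooth_on U F"
    and e: "e differentiable (at u)" and V: "V differentiable (at u)"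
    and al: "al differentiable (at u)"
    and eq: "\<And>y h. y \<in> U \<Longrightarrow> fderiv F y h = al y *\<^sub>R fderiv X y h + B (fderiv X y h) (e y) *\<^sub>R V y"
  shows "fderiv al u k *\<^sub>R fderiv X u h + B (fderiv X u h) (fderiv e u k) *\<^sub>R V u
           + B (fderiv X u h) (e u) *\<^sub>R fderiv V u k
       = fderiv al u h *\<^sub>R fderiv X u k + B (fderiv X u k) (fderiv e u h) *\<^sub>R V u
           + B (fderiv X u k) (e u) *\<^sub>R fderiv V u h"
proof -
  interpret bounded_bilinear B by (rule bb)
  note Xh = fderiv_has[OF smooth_on_fderiv_differentiable[OF X U]]
  \<comment> \<open>All terms with a second derivative of \<open>X\<close> stand in front; the
    bracket is the part whose symmetry is to be shown.\<close>
  have *: "fderiv (\<lambda>y. fderiv F y h) u k =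
      al u *\<^sub>R fderiv (\<lambda>y. fderiv X y h) u k + B (fderiv (\<lambda>y. fderiv X y h) u k) (e u) *\<^sub>R V u
      + (fderiv al u k *\<^sub>R fderiv X u h + B (fderiv X u h) (fderiv e u k) *\<^sub>R V u
           + B (fderiv X u h) (e u) *\<^sub>R fderiv V u k)" for h k
  proof -
    have "((\<lambda>y. al y *\<^sub>R fderiv X y h + B (fderiv X y h) (e y) *\<^sub>R V y) has_derivative
      (\<lambda>k. (al u *\<^sub>R fderiv (\<lambda>y. fderiv X y h) u k + fderiv al u k *\<^sub>R fderiv X u h)
        + (B (fderiv X u h) (e u) *\<^sub>R fderiv V u k
          + (B (fderiv X u h) (fderiv e u k) + B (fderiv (\<lambda>y. fderiv X y h) u k) (e u)) *\<^sub>R V u))) (at u)"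
      by (intro has_derivative_add has_derivative_scaleR FDERIV Xh fderiv_has al e V)
    from has_derivative_transform_within_open[OF this U, where g = "\<lambda>y. fderiv F y h"]
    show ?thesis by (subst fderivI) (auto simp: eq algebra_simps)
  qed
  show ?thesis
    using *[of h k] *[of k h] smooth_on_second_fderiv_sym[OF F U, of h k]
      smooth_on_second_fderiv_sym[OF X U, of h k] by simp
qed

text \<open>\<open>hn u\<close> and \<open>S u\<close> live in the parameter space: the differential of \<open>X\<close> at \<open>u\<close> sends
  \<open>hn u\<close> to \<open>e\<^sub>n\<close> and \<open>S u\<close> to \<open>{e\<^sub>1, \<dots>, e\<^sub>n\<^sub>-\<^sub>1}\<close>. Thus \<open>\<theta> u h\<close> below is the
  \<open>e\<^sub>n\<close>-component of the tangent vector with parameter \<open>h\<close>.\<close>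

locale two_curvature_chart =
  fixes B :: "'b::euclidean_space \<Rightarrow> 'b \<Rightarrow> real" and U :: "'a::euclidean_space set"
    and X N e :: "'a \<Rightarrow> 'b" and hn :: "'a \<Rightarrow> 'a" and S :: "'a \<Rightarrow> 'a set"
    and lam mu :: "'a \<Rightarrow> real" and a b d H :: real
  assumes bb: "bounded_bilinear B" and sym: "B v v' = B v' v"
    and U: "open U" and X: "smooth_on U X" and N: "smooth_on U N" and e: "smooth_on U e"
    and lam: "smooth_on U lam"
    and n3: "DIM('a) \<ge> 3" and dim: "DIM('b) = DIM('a) + (if a = 0 then 1 else 2)"
    and a: "a \<in> {-1, 0, 1}" and b: "b \<in> {-1, 1}" and d: "d \<in> {-1, 1}"
    and N_normal: "u \<in> U \<Longrightarrow> B (N u) (fderiv X u h) = 0"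
    and N_norm: "u \<in> U \<Longrightarrow> B (N u) (N u) = b"
    and e_norm: "u \<in> U \<Longrightarrow> B (e u) (e u) = d"
    and X_norm: "a \<noteq> 0 \<Longrightarrow> u \<in> U \<Longrightarrow> B (X u) (X u) = a"
    and N_X: "a \<noteq> 0 \<Longrightarrow> u \<in> U \<Longrightarrow> B (N u) (X u) = 0"
    and hn: "u \<in> U \<Longrightarrow> fderiv X u (hn u) = e u"
    and N_hn: "u \<in> U \<Longrightarrow> fderiv N u (hn u) = - mu u *\<^sub>R e u"
    and S: "u \<in> U \<Longrightarrow> finite (S u)" "u \<in> U \<Longrightarrow> card (S u) = DIM('a) - 1"
    and N_S: "u \<in> U \<Longrightarrow> k \<in> S u \<Longrightarrow> fderiv N u k = - lam u *\<^sub>R fderiv X u k"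
    and S_e: "u \<in> U \<Longrightarrow> k \<in> S u \<Longrightarrow> B (fderiv X u k) (e u) = 0"
    and S_orth: "u \<in> U \<Longrightarrow> k \<in> S u \<Longrightarrow> l \<in> S u \<Longrightarrow> k \<noteq> l \<Longrightarrow> B (fderiv X u k) (fderiv X u l) = 0"
    and S_norm: "u \<in> U \<Longrightarrow> k \<in> S u \<Longrightarrow> B (fderiv X u k) (fderiv X u k) \<noteq> 0"
    and mu_less: "u \<in> U \<Longrightarrow> mu u < lam u"
    and cmc: "u \<in> U \<Longrightarrow> (real DIM('a) - 1) * lam u + mu u = real DIM('a) * H"
begin

sublocale B: bounded_bilinear B by (rule bb)

section \<open>The adapted frame and its metric relations\<close>

lemma d_square [simp]: "d * d = 1" "d * (d * z) = z" "d \<noteq> 0" and b_square [simp]: "b * b = 1" "b * (b * z) = z" "b \<noteq> 0"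
  using b d by auto

lemmas X_has = fderiv_has[OF smooth_on_differentiable[OF X]]
  and N_has = fderiv_has[OF smooth_on_differentiable[OF N]]
  and e_has = fderiv_has[OF smooth_on_differentiable[OF e]]
  and lam_has = fderiv_has[OF smooth_on_differentiable[OF lam]]

lemmas lin_X = has_derivative_linear[OF X_has]
  and lin_N = has_derivative_linear[OF N_has]
  and lin_e = has_derivative_linear[OF e_has]
  and lin_lam = has_derivative_linear[OF lam_has]

definition "\<theta> u h = d * B (fderiv X u h) (e u)"
definition "\<rho> u = lam u - mu u"

lemma \<rho>_pos: "u \<in> U \<Longrightarrow> \<rho> u > 0"
  using mu_less by (simp add: \<rho>_def)

lemma \<theta>_hn: "u \<in> U \<Longrightarrow> \<theta> u (hn u) = 1"
  by (simp add: \<theta>_def hn e_norm)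

lemma \<theta>_S: "u \<in> U \<Longrightarrow> k \<in> S u \<Longrightarrow> \<theta> u k = 0"
  by (simp add: \<theta>_def S_e)

lemma lin_\<theta>: "u \<in> U \<Longrightarrow> linear (\<theta> u)"
  by (rule linearI)
    (simp_all add: \<theta>_def linear_add[OF lin_X] linear_cmul[OF lin_X] B.add_left B.scaleR_left distrib_left)

lemma lin_\<theta>_mult: "u \<in> U \<Longrightarrow> linear (\<lambda>h. \<theta> u h * c)"
  by (rule linearI) (simp_all add: linear_add[OF lin_\<theta>] linear_cmul[OF lin_\<theta>] distrib_right)

lemma linear_structure_rhs: "u \<in> U \<Longrightarrow> linear (\<lambda>h. c *\<^sub>R fderiv X u h + (\<theta> u h * r) *\<^sub>R v)"
  by (rule linearI) (simp_all add: linear_add[OF lin_X] linear_cmul[OF lin_X]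
      linear_add[OF lin_\<theta>] linear_cmul[OF lin_\<theta>] algebra_simps)

text \<open>For the pulled back form, \<open>hn u\<close> and the elements of \<open>S u\<close> are
  orthogonal with nonzero squares, hence a basis of the parameter space. Identities of linear maps
  need checking on principal directions only.\<close>

lemma linear_eq_on_frame:
  assumes u: "u \<in> U" and lin: "linear \<phi>" "linear \<psi>"
    and "\<And>k. k \<in> S u \<Longrightarrow> \<phi> k = \<psi> k" "\<phi> (hn u) = \<psi> (hn u)"
  shows "\<phi> h = \<psi> h"
proof -
  let ?T = "insert (hn u) (S u)"
  let ?B = "\<lambda>h k. B (fderiv X u h) (fderiv X u k)"
  have bil: "bilinear ?B"
    unfolding bilinear_def
    by (intro allI conjI linearI) (simp_all add: linear_add[OF lin_X[OF u]] linear_cmul[OF lin_X[OF u]]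
        B.add_left B.scaleR_left B.add_right B.scaleR_right)
  \<comment> \<open>\<open>\<theta> u\<close> takes the value 1 at \<open>hn u\<close> and 0 on
    \<open>S u\<close>; this makes the count of vectors right.\<close>
  have "hn u \<notin> S u" using \<theta>_hn[OF u] \<theta>_S[OF u] by force
  then have "card ?T \<ge> DIM('a)" using S[OF u] by simp
  moreover have "finite ?T" using S[OF u] by simp
  moreover have "?B s t = 0" if "s \<in> ?T" "t \<in> ?T" "s \<noteq> t" for s t
    using that S_e[OF u] S_orth[OF u] sym hn[OF u] by auto
  moreover have "?B s s \<noteq> 0" if "s \<in> ?T" for s
    using that S_norm[OF u] hn[OF u] e_norm[OF u] by auto
  ultimately have h: "h = (\<Sum>s\<in>?T. (?B h s / ?B s s) *\<^sub>R s)"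
    using orthogonal_expansion[OF bil, of ?T h] by blast
  have "\<phi> s = \<psi> s" if "s \<in> ?T" for s using assms that by blast
  then show ?thesis
    by (subst (1 2) h) (simp add: linear_sum[OF lin(1)] linear_sum[OF lin(2)] linear_cmul[OF lin(1)] linear_cmul[OF lin(2)] del: sum.insert)
qed

text \<open>At \<open>hn u\<close> the two coefficients add up to \<open>- lam u + \<rho> u\<close>,
  that is, to \<open>- mu u\<close>.\<close>

lemma fderiv_N: "u \<in> U \<Longrightarrow> fderiv N u h = - lam u *\<^sub>R fderiv X u h + (\<theta> u h * \<rho> u) *\<^sub>R e u"
  by (rule linear_eq_on_frame[OF _ lin_N linear_structure_rhs])
    (auto simp: N_S \<theta>_S \<theta>_hn N_hn hn \<rho>_def algebra_simps)

text \<open>By \<open>fderiv_N\<close> the hypothesis leaves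
  \<open>(\<theta> u h * \<rho> u) *\<^sub>R e u = 0\<close>, where \<open>\<rho> u\<close> and
  \<open>e u\<close> are nonzero. This translates membership in \<Gamma> into a condition on
  \<open>\<theta>\<close>.\<close>

lemma \<theta>_eq_0_if_eigenvector: "u \<in> U \<Longrightarrow> fderiv N u h = - lam u *\<^sub>R fderiv X u h \<Longrightarrow> \<theta> u h = 0"
  using fderiv_N[of u h] \<rho>_pos[of u] e_norm[of u] by (auto simp: B.zero_left)

lemma const_form_fderiv:
  assumes "u \<in> U" and "\<And>y. y \<in> U \<Longrightarrow> B (P y) (Q y) = c"
    and P: "P differentiable (at u)" and Q: "Q differentiable (at u)"
  shows "B (P u) (fderiv Q u h) = - B (fderiv P u h) (Q u)"
proof -
  have "((\<lambda>y. B (P y) (Q y)) has_derivative (\<lambda>h. B (P u) (fderiv Q u h) + B (fderiv P u h) (Q u))) (at u)"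
    by (intro B.FDERIV fderiv_has P Q)
  moreover have "((\<lambda>y. B (P y) (Q y)) has_derivative (\<lambda>h. 0)) (at u)"
    using assms(1,2) by (intro has_derivative_transform_within_open[OF has_derivative_const U, of u c]) auto
  ultimately have "(\<lambda>h. B (P u) (fderiv Q u h) + B (fderiv P u h) (Q u)) = (\<lambda>h. 0)"
    by (rule has_derivative_unique)
  then show ?thesis by (metis eq_neg_iff_add_eq_0)
qed

lemmas differentiable_at = smooth_on_differentiable[OF X] smooth_on_differentiable[OF N]
  smooth_on_differentiable[OF e] smooth_on_differentiable[OF lam]

lemma e_fderiv_e: "u \<in> U \<Longrightarrow> B (e u) (fderiv e u h) = 0"
  using const_form_fderiv[of u e e d h] e_norm differentiable_at sym[of "e u"] by force

lemma X_fderiv_X: "a \<noteq> 0 \<Longrightarrow> u \<in> U \<Longrightarrow> B (X u) (fderiv X u h) = 0"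
  using const_form_fderiv[of u X X a h] X_norm differentiable_at sym[of "X u"] by force

lemma N_e: "u \<in> U \<Longrightarrow> B (N u) (e u) = 0"
  using N_normal[of u "hn u"] hn by simp

lemma X_e: "a \<noteq> 0 \<Longrightarrow> u \<in> U \<Longrightarrow> B (X u) (e u) = 0"
  using X_fderiv_X[of u "hn u"] hn by simp

text \<open>Dimension at least 3 enters decisively here: \<Gamma> contains two different frame
  vectors that can be compared.\<close>

lemma obtain_other:
  assumes "u \<in> U" "k \<in> S u" obtains l where "l \<in> S u" "l \<noteq> k"
proof -
  have "card (S u) \<ge> 2" using n3 S(2)[OF assms(1)] by simp
  then have "\<not> S u \<subseteq> {k}" using card_mono[of "{k}" "S u"] by auto
  then show thesis using that by blast
qed

text \<open>Two applications of this lemma carry the proof: to the Gauss map, where it is the Codazzi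
  equation, and to the field \<open>e\<close>, where it is flatness of the ambient derivative.\<close>

lemma codazzi_type:
  assumes u: "u \<in> U" and F: "smooth_on U F"
    and V: "V differentiable (at u)" and al: "al differentiable (at u)"
    and eq: "\<And>y h. y \<in> U \<Longrightarrow> fderiv F y h = al y *\<^sub>R fderiv X y h + \<theta> y h *\<^sub>R V y"
    and perp: "\<And>k. k \<in> S u \<Longrightarrow> B (V u) (fderiv X u k) = 0"
    and k: "k \<in> S u"
  shows "fderiv al u k = 0"
    "fderiv V u k = fderiv al u (hn u) *\<^sub>R fderiv X u k + (d * B (fderiv X u k) (fderiv e u (hn u))) *\<^sub>R V u"
proof -
  have dV: "(\<lambda>y. d *\<^sub>R V y) differentiable (at u)" using V by simp
  have dV': "fderiv (\<lambda>y. d *\<^sub>R V y) u h = d *\<^sub>R fderiv V u h" for h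
    by (subst fderivI) (auto intro!: derivative_intros fderiv_has V)
  \<comment> \<open>The factor \<open>d\<close> inside \<open>\<theta>\<close> is moved to the
    vector, as \<open>symmetrized_structure_equation\<close> has the bare form \<open>B\<close>
    there.\<close>
  have eq': "fderiv F y h = al y *\<^sub>R fderiv X y h + B (fderiv X y h) (e y) *\<^sub>R (d *\<^sub>R V y)" if "y \<in> U" for y h
    using eq[OF that, of h] by (simp add: \<theta>_def mult.commute)
  note sse = symmetrized_structure_equation[OF bb U u X F differentiable_at(3)[OF u] dV al eq', unfolded dV']
  obtain l where l: "l \<in> S u" "l \<noteq> k" using obtain_other[OF u k] .
  \<comment> \<open>For two directions in \<open>S u\<close> the derivatives of \<open>V\<close>
    drop out. Pairing with the image of \<open>l\<close> also removes the multiples of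
    \<open>V u\<close> and of the image of \<open>k\<close>.\<close>
  have "B (fderiv al u k *\<^sub>R fderiv X u l + B (fderiv X u l) (fderiv e u k) *\<^sub>R d *\<^sub>R V u) (fderiv X u l)
      = B (fderiv al u l *\<^sub>R fderiv X u k + B (fderiv X u k) (fderiv e u l) *\<^sub>R d *\<^sub>R V u) (fderiv X u l)"
    using sse[of k l] by (simp add: S_e[OF u] k l)
  then have "fderiv al u k * B (fderiv X u l) (fderiv X u l) = 0"
    by (simp add: B.add_left B.scaleR_left perp l S_orth[OF u k l(1) l(2)[symmetric]])
  then show 0: "fderiv al u k = 0" using S_norm[OF u l(1)] by simp
  \<comment> \<open>Now the directions are \<open>k\<close> and \<open>hn u\<close>: since
    \<open>B (e u) (e u) = d\<close>, the derivative of \<open>V\<close> survives with the factor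
    \<open>d * d = 1\<close>.\<close>
  have "fderiv V u k = d *\<^sub>R d *\<^sub>R fderiv V u k" by simp
  also have "d *\<^sub>R d *\<^sub>R fderiv V u k = fderiv al u (hn u) *\<^sub>R fderiv X u k + B (fderiv X u k) (fderiv e u (hn u)) *\<^sub>R d *\<^sub>R V u"
    using sse[of k "hn u"] by (simp add: S_e[OF u k] hn[OF u] e_norm[OF u] e_fderiv_e[OF u] 0)
  finally show "fderiv V u k = fderiv al u (hn u) *\<^sub>R fderiv X u k + (d * B (fderiv X u k) (fderiv e u (hn u))) *\<^sub>R V u"
    by (simp add: mult.commute)
qed

section \<open>Derivatives of the principal curvatures and of \<open>e\<close>\<close>

lemma mu_eq: "u \<in> U \<Longrightarrow> mu u = real DIM('a) * H - (real DIM('a) - 1) * lam u"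
  using cmc[of u] by simp

lemma mu_has: "u \<in> U \<Longrightarrow> (mu has_derivative (\<lambda>h. - (real DIM('a) - 1) * fderiv lam u h)) (at u)"
  by (rule has_derivative_transform_within_open[OF _ U,
        where f = "\<lambda>y. real DIM('a) * H - (real DIM('a) - 1) * lam y"])
    (auto simp: mu_eq fun_eq_iff algebra_simps intro!: derivative_eq_intros lam_has)

lemma \<rho>_has: "u \<in> U \<Longrightarrow> (\<rho> has_derivative (\<lambda>h. real DIM('a) * fderiv lam u h)) (at u)"
  unfolding \<rho>_def[abs_def] by (auto intro!: derivative_eq_intros lam_has mu_has simp: algebra_simps)

definition "g u = - fderiv lam u (hn u) / \<rho> u"

text \<open>\<open>codazzi_type\<close> with \<open>F = N\<close>, \<open>V = \<rho> e\<close> and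
  \<open>al = - lam\<close>: its first conclusion makes \<open>lam\<close> constant along \<Gamma>,
  its second determines the derivative of \<open>e\<close> along \<Gamma>.\<close>

lemma
  assumes u: "u \<in> U"
  shows fderiv_lam: "fderiv lam u h = - \<theta> u h * \<rho> u * g u"
    and fderiv_e_S: "k \<in> S u \<Longrightarrow> fderiv e u k = g u *\<^sub>R fderiv X u k"
    and S_fderiv_e: "k \<in> S u \<Longrightarrow> B (fderiv X u k) (fderiv e u (hn u)) = 0"
proof -
  let ?V = "\<lambda>y. \<rho> y *\<^sub>R e y"
  have V: "(?V has_derivative (\<lambda>h. \<rho> u *\<^sub>R fderiv e u h + (real DIM('a) * fderiv lam u h) *\<^sub>R e u)) (at u)"
    by (intro has_derivative_scaleR \<rho>_has e_has u)
  have l: "((\<lambda>y. - lam y) has_derivative (\<lambda>h. - fderiv lam u h)) (at u)"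
    by (intro has_derivative_minus lam_has u)
  have cod: "fderiv (\<lambda>y. - lam y) u k = 0"
    "fderiv ?V u k = fderiv (\<lambda>y. - lam y) u (hn u) *\<^sub>R fderiv X u k + (d * B (fderiv X u k) (fderiv e u (hn u))) *\<^sub>R ?V u"
    if "k \<in> S u" for k
    using that u fderiv_N S_e sym[of "e u"] differentiableI[OF V] differentiableI[OF l] B.scaleR_left
    by (intro codazzi_type[OF u N, of ?V "\<lambda>y. - lam y"]; force)+
  have dl: "fderiv lam u k = 0" if "k \<in> S u" for k using cod(1)[OF that] fderivI[OF l] by simp
  have "fderiv lam u h = \<theta> u h * (- \<rho> u * g u)"
    by (rule linear_eq_on_frame[OF u lin_lam[OF u] lin_\<theta>_mult[OF u]])
      (use dl \<rho>_pos[OF u] in \<open>auto simp: \<theta>_S[OF u] \<theta>_hn[OF u] g_def\<close>)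
  then show "fderiv lam u h = - \<theta> u h * \<rho> u * g u" by simp
  assume k: "k \<in> S u"
  have eq: "\<rho> u *\<^sub>R fderiv e u k = - fderiv lam u (hn u) *\<^sub>R fderiv X u k
      + (d * B (fderiv X u k) (fderiv e u (hn u)) * \<rho> u) *\<^sub>R e u"
    using cod(2)[OF k] by (simp add: fderivI[OF V] fderivI[OF l] dl[OF k])
  \<comment> \<open>Since \<open>e\<close> has constant square, its derivative is orthogonal to
    \<open>e\<close>; so the \<open>e\<close>-component on the right of \<open>eq\<close> must
    vanish.\<close>
  have "B (e u) (\<rho> u *\<^sub>R fderiv e u k) = 0" by (simp add: B.scaleR_right e_fderiv_e u)
  then have "d * B (fderiv X u k) (fderiv e u (hn u)) * \<rho> u * d = 0"
    unfolding eq using sym[of "e u" "fderiv X u k"] by (simp add: B.diff_right B.add_right B.scaleR_right S_e u k e_norm B.minus_right)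
  then show 0: "B (fderiv X u k) (fderiv e u (hn u)) = 0" using \<rho>_pos[OF u] by simp
  have "\<rho> u *\<^sub>R fderiv e u k = \<rho> u *\<^sub>R g u *\<^sub>R fderiv X u k"
    using eq \<rho>_pos[OF u] by (simp add: 0 g_def)
  then show "fderiv e u k = g u *\<^sub>R fderiv X u k"
    using \<rho>_pos[OF u] by (metis less_irrefl scaleR_cancel_left)
qed

text \<open>Both sides have the same products with an orthogonal basis of the ambient space. The
  products on the left come from differentiating the constant products of \<open>e\<close> with
  \<open>X\<close>, \<open>N\<close> and \<open>e\<close>, and from
  \<open>S_fderiv_e\<close>.\<close>

lemma fderiv_e_hn:
  assumes u: "u \<in> U"
  shows "fderiv e u (hn u) = (b * d * mu u) *\<^sub>R N u - (a * d) *\<^sub>R X u" (is "?l = ?r")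
proof -
  let ?T = "fderiv X u ` S u"
  define W where "W = insert (e u) (insert (N u) ?T)"
  \<comment> \<open>The position vector is normal to the hypersurface for
    \<open>a \<noteq> 0\<close> and then completes the basis; in the flat case \<open>e\<close>,
    \<open>N\<close> and the images of \<open>S u\<close> already suffice.\<close>
  let ?Y = "if a = 0 then {} else {X u}"
  have inj: "inj_on (fderiv X u) (S u)"
    using S_orth[OF u] S_norm[OF u] by (auto intro!: inj_onI) metis
  have T: "finite ?T" "card ?T = DIM('a) - 1"
    using S[OF u] card_image[OF inj] by auto
  have "N u \<notin> ?T" using N_norm[OF u] N_normal[OF u] by force
  moreover have "e u \<notin> insert (N u) ?T" using e_norm[OF u] N_e[OF u] S_e[OF u] by force
  ultimately have W: "finite W" "card W = DIM('a) + 1" using T n3 by (auto simp: W_def)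
  have "X u \<notin> W" if "a \<noteq> 0"
    unfolding W_def using that X_norm[OF that u] X_e[OF that u] N_X[OF that u] X_fderiv_X[OF that u] by force
  then have "finite (?Y \<union> W)" "card (?Y \<union> W) \<ge> DIM('b)"
    using W dim by auto
  moreover have "bilinear B" using bb by (simp add: bilinear_conv_bounded_bilinear)
  moreover have "B s t = 0" if "s \<in> ?Y \<union> W" "t \<in> ?Y \<union> W" "s \<noteq> t" for s t
    using that S_orth[OF u] S_e[OF u] N_e[OF u] N_normal[OF u] X_e[OF _ u] N_X[OF _ u] X_fderiv_X[OF _ u] sym
    by (auto simp: W_def split: if_splits)
  moreover have "B s s \<noteq> 0" if "s \<in> ?Y \<union> W" for s
    using that S_norm[OF u] e_norm[OF u] N_norm[OF u] X_norm[OF _ u] by (auto simp: W_def split: if_splits)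
  moreover have "B (?l - ?r) s = 0" if "s \<in> ?Y \<union> W" for s
  proof -
    have "s = X u \<and> a \<noteq> 0 \<or> s = e u \<or> s = N u \<or> s \<in> ?T"
      using that by (auto simp: W_def split: if_splits)
    then consider "s = X u" "a \<noteq> 0" | "s = e u" | "s = N u" | k where "k \<in> S u" "s = fderiv X u k"
      by blast
    then show ?thesis
    proof cases
      case 1
      \<comment> \<open>Dividing by \<open>B (X u) (X u) = a\<close>, which is its own inverse,
        yields the coefficient \<open>- a * d\<close>.\<close>
      have "B (X u) (fderiv e u (hn u)) = - d"
        using const_form_fderiv[of u X e 0 "hn u"] X_e 1 u differentiable_at hn e_norm by auto
      then show ?thesis using 1 a X_norm[OF _ u] N_X[OF _ u] sym[of "fderiv e u (hn u)"]
        by (auto simp: B.diff_left B.scaleR_left)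
    next
      case 2
      then show ?thesis using e_fderiv_e[OF u] sym[of _ "e u"] N_e[OF u] X_e[OF _ u] sym
        by (auto simp: B.diff_right B.scaleR_right)
    next
      case 3
      \<comment> \<open>Dividing by \<open>b\<close>, which is its own inverse, yields the
        coefficient \<open>b * d * mu u\<close>.\<close>
      have "B (N u) (fderiv e u (hn u)) = mu u * d"
        using const_form_fderiv[of u N e 0 "hn u"] N_e u differentiable_at N_hn e_norm by (simp add: B.scaleR_left B.minus_left)
      then show ?thesis using 3 N_norm[OF u] N_X[OF _ u] sym[of "fderiv e u (hn u)"] sym[of "X u" "N u"]
        by (cases "a = 0") (simp_all add: B.diff_left B.scaleR_left mult_ac)
    next
      case 4
      then show ?thesis using S_fderiv_e[OF u] N_normal[OF u] X_fderiv_X[OF _ u] sym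
        by (auto simp: B.diff_right B.scaleR_right)
    qed
  qed
  ultimately have "?l - ?r = 0" by (intro orthogonal_to_basis_zero[of B "?Y \<union> W"])
  then show ?thesis by simp
qed

text \<open>The subtracted multiple of \<open>e\<close> compensates for
  \<open>g u *\<^sub>R fderiv X u (hn u)\<close>, so that the derivative of \<open>e\<close> also
  has the shape required by \<open>codazzi_type\<close>.\<close>

definition "V u = (b * d * mu u) *\<^sub>R N u - (a * d) *\<^sub>R X u - g u *\<^sub>R e u"

lemma fderiv_e:
  assumes u: "u \<in> U"
  shows "fderiv e u h = g u *\<^sub>R fderiv X u h + \<theta> u h *\<^sub>R V u"
  by (rule linear_eq_on_frame[OF u lin_e[OF u] linear_structure_rhs[OF u, of _ 1, simplified]])
    (auto simp: fderiv_e_S[OF u] \<theta>_S[OF u] \<theta>_hn[OF u] fderiv_e_hn[OF u] hn[OF u] V_def algebra_simps)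

text \<open>\<open>hn\<close> is chosen pointwise, without regularity, so the definition of
  \<open>g\<close> cannot be differentiated directly. With the direction frozen at
  \<open>hn u\<close>, \<open>fderiv_lam\<close> writes \<open>g\<close> near \<open>u\<close> as a
  quotient of differentiable functions.\<close>

lemma g_differentiable:
  assumes u: "u \<in> U" shows "g differentiable (at u)"
proof -
  let ?q = "\<lambda>y. \<theta> y (hn u)"
  let ?G = "\<lambda>y. - fderiv lam y (hn u) / (?q y * \<rho> y)"
  have q: "?q differentiable (at u)"
    using B.FDERIV[OF fderiv_has[OF smooth_on_fderiv_differentiable[OF X U u]] e_has[OF u]]
    unfolding \<theta>_def by (auto intro: differentiableI)
  then have "isCont ?q u" by (rule differentiable_imp_continuous_within)
  then have "eventually (\<lambda>y. ?q y \<noteq> 0) (nhds u)"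
    using \<theta>_hn[OF u] by (intro tendsto_imp_eventually_ne[where c = 1]) (auto simp: isCont_def tendsto_nhds_iff)
  then obtain W where W: "open W" "u \<in> W" "\<And>y. y \<in> W \<Longrightarrow> ?q y \<noteq> 0"
    unfolding eventually_nhds by blast
  have "?G differentiable (at u)"
    using q differentiableI[OF \<rho>_has[OF u]] smooth_on_fderiv_differentiable[OF lam U u] \<theta>_hn[OF u] \<rho>_pos[OF u]
    by (intro differentiable_divide differentiable_minus differentiable_mult) auto
  moreover have "?G y = g y" if "y \<in> W \<inter> U" for y
    using that W(3)[of y] \<rho>_pos[of y] by (simp add: fderiv_lam)
  ultimately show ?thesis
    using has_derivative_transform_within_open[of ?G _ u UNIV "W \<inter> U" g] W U u
    unfolding differentiable_def by blast
qed

lemma V_has: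
  assumes u: "u \<in> U"
  shows "(V has_derivative (\<lambda>h. (b * d * mu u) *\<^sub>R fderiv N u h + (- b * d * (real DIM('a) - 1) * fderiv lam u h) *\<^sub>R N u
      - (a * d) *\<^sub>R fderiv X u h - (g u *\<^sub>R fderiv e u h + fderiv g u h *\<^sub>R e u))) (at u)"
  unfolding V_def[abs_def]
  by (rule derivative_eq_intros mu_has N_has X_has e_has fderiv_has g_differentiable u refl)+ (simp add: algebra_simps)

text \<open>\<open>codazzi_type\<close> with \<open>F = e\<close> and \<open>al = g\<close> makes
  \<open>g\<close> constant along \<Gamma> and the derivative of \<open>V\<close> there
  \<open>fderiv g u (hn u)\<close> times that of \<open>X\<close>. Computing the same derivative
  from the definition of \<open>V\<close> gives the value.\<close>

lemma fderiv_g: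
  assumes u: "u \<in> U"
  shows "fderiv g u h = - \<theta> u h * (b * d * mu u * lam u + a * d + (g u)\<^sup>2)"
proof -
  have perp: "B (V u) (fderiv X u k) = 0" if "k \<in> S u" for k
    using that N_normal[OF u] X_fderiv_X[OF _ u] S_e[OF u] sym[of "e u"]
    by (auto simp: V_def B.diff_left B.scaleR_left)
  note cod = codazzi_type[OF u e differentiableI[OF V_has[OF u]] g_differentiable[OF u] fderiv_e perp]
  have g0: "fderiv g u k = 0" if "k \<in> S u" for k using cod(1) that by blast
  have "S u \<noteq> {}" using S(2)[OF u] n3 by auto
  then obtain k where k: "k \<in> S u" by blast
  have "B (fderiv X u k) (fderiv V u k) = fderiv g u (hn u) * B (fderiv X u k) (fderiv X u k)"
    using cod(2)[OF _ _ k] by (simp add: S_fderiv_e[OF u k] B.scaleR_right)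
  \<comment> \<open>Along \<Gamma> the scalars in \<open>V\<close> are constant, and
    \<open>N\<close>, \<open>X\<close>, \<open>e\<close> all have derivatives proportional to that
    of \<open>X\<close>.\<close>
  moreover have "fderiv V u k = - (b * d * mu u * lam u + a * d + (g u)\<^sup>2) *\<^sub>R fderiv X u k"
    by (simp add: fderivI[OF V_has[OF u]] N_S[OF u k] fderiv_lam[OF u] \<theta>_S[OF u k] fderiv_e_S[OF u k] g0[OF k]
        power2_eq_square algebra_simps)
  ultimately have *: "fderiv g u (hn u) = - (b * d * mu u * lam u + a * d + (g u)\<^sup>2)"
    using S_norm[OF u k] by (simp add: B.scaleR_right)
  have "fderiv g u h = \<theta> u h * - (b * d * mu u * lam u + a * d + (g u)\<^sup>2)"
    by (rule linear_eq_on_frame[OF u has_derivative_linear[OF fderiv_has[OF g_differentiable[OF u]]]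
          lin_\<theta>_mult[OF u]])
      (use g0 * in \<open>auto simp: \<theta>_S[OF u] \<theta>_hn[OF u]\<close>)
  then show ?thesis by (simp only: mult_minus_left mult_minus_right)
qed

section \<open>The function \<open>w\<close>, the first integral and the fields \<open>eta\<close>
  and \<open>Z\<close>\<close>

definition "w u = (lam u - H) powr (- 1 / real DIM('a))"

lemma lam_H: "u \<in> U \<Longrightarrow> lam u - H = \<rho> u / real DIM('a)"
  using cmc[of u] by (simp add: \<rho>_def field_simps)

lemma w_pos: "u \<in> U \<Longrightarrow> w u > 0"
  using lam_H[of u] \<rho>_pos[of u] by (auto simp: w_def)

text \<open>The exponent -1/n cancels the factor n in \<open>lam u - H = \<rho> u / n\<close>: the
  logarithmic derivative of \<open>w\<close> is that of \<open>lam\<close> divided by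
  \<open>- \<rho>\<close>, hence \<open>\<theta> u h * g u\<close>.\<close>

lemma w_has:
  assumes u: "u \<in> U"
  shows "(w has_derivative (\<lambda>h. \<theta> u h * (g u * w u))) (at u)"
proof -
  have p: "lam u - H > 0" using lam_H[OF u] \<rho>_pos[OF u] by simp
  \<comment> \<open>The term with \<open>ln\<close> comes from the constant exponent and has the
    factor 0.\<close>
  have "((\<lambda>y. (lam y - H) powr (- 1 / real DIM('a))) has_derivative
      (\<lambda>h. w u * (0 * ln (lam u - H) + fderiv lam u h * (- 1 / real DIM('a)) / (lam u - H)))) (at u)"
    unfolding w_def using p
    by (intro has_derivative_powr[where X = UNIV] has_derivative_const) (auto intro!: derivative_eq_intros lam_has u)
  moreover have "w u * (0 * ln (lam u - H) + fderiv lam u h * (- 1 / real DIM('a)) / (lam u - H)) = \<theta> u h * (g u * w u)" for h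
    using \<rho>_pos[OF u] by (simp add: lam_H[OF u] fderiv_lam[OF u])
  ultimately show ?thesis by (simp add: w_def[abs_def])
qed

definition "f u = fderiv w u (hn u)"

lemma f_eq: "u \<in> U \<Longrightarrow> f u = g u * w u"
  using fderivI[OF w_has] by (simp add: f_def \<theta>_hn)

text \<open>In the derivative of \<open>g * w\<close> the quadratic term of \<open>fderiv_g\<close>
  cancels against \<open>g\<close> times the derivative of \<open>w\<close>. At \<open>hn u\<close>
  this is the second order equation for \<open>w\<close>.\<close>

lemma f_has:
  assumes u: "u \<in> U"
  shows "(f has_derivative (\<lambda>h. - \<theta> u h * w u * (b * d * mu u * lam u + a * d))) (at u)"
proof -
  have "((\<lambda>y. g y * w y) has_derivative (\<lambda>h. g u * (\<theta> u h * (g u * w u)) + fderiv g u h * w u)) (at u)"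
    by (intro has_derivative_mult fderiv_has g_differentiable w_has u)
  from has_derivative_transform_within_open[OF this U u, of f] f_eq
  show ?thesis by (simp add: fderiv_g[OF u] power2_eq_square algebra_simps)
qed

definition "Cf u = (f u)\<^sup>2 + d * (w u)\<^sup>2 * (a + b * (lam u)\<^sup>2)"
definition "eta u = - f u *\<^sub>R e u + (d * b * lam u * w u) *\<^sub>R N u - (d * a * w u) *\<^sub>R X u"
definition "Z u = (lam u * w u) *\<^sub>R e u + f u *\<^sub>R N u"

text \<open>\<open>Cf\<close> is a first integral of that equation: all contributions are multiples
  of \<open>\<theta> u h * g u * (w u)\<^sup>2\<close> and add up to zero because
  \<open>\<rho> = lam - mu\<close>.\<close>

lemma Cf_has:
  assumes u: "u \<in> U" shows "(Cf has_derivative (\<lambda>h. 0)) (at u)"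
  unfolding Cf_def[abs_def]
  by (rule derivative_eq_intros f_has w_has lam_has u refl)+
    (simp add: fun_eq_iff f_eq[OF u] fderiv_lam[OF u] \<rho>_def power2_eq_square algebra_simps)

text \<open>The last bracket is the \<Gamma>-component of \<open>fderiv X u h\<close>. One formula
  thus covers both claims: it vanishes at \<open>hn u\<close> and is the multiple
  \<open>- Cf u / w u\<close> along \<Gamma>.\<close>

lemma eta_has:
  assumes u: "u \<in> U"
  shows "(eta has_derivative (\<lambda>h. - (Cf u / w u) *\<^sub>R (fderiv X u h - \<theta> u h *\<^sub>R e u))) (at u)"
proof -
  have c: "Cf u / w u = g u * g u * w u + d * w u * (a + b * lam u * lam u)"
    using w_pos[OF u] by (simp add: Cf_def f_eq[OF u] field_simps power2_eq_square)
  show ?thesis unfolding eta_def[abs_def] c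
    by (rule derivative_eq_intros f_has w_has lam_has e_has N_has X_has u refl)+
      (simp add: fun_eq_iff f_eq[OF u] fderiv_lam[OF u] fderiv_N[OF u] fderiv_e[OF u] V_def \<rho>_def algebra_simps)
qed

text \<open>Along \<Gamma> the contributions of \<open>e\<close> and \<open>N\<close> cancel because
  \<open>f = g * w\<close>. Along \<open>e\<close> the only remainder is
  \<open>- a * d * w u\<close> times \<open>N u + lam u *\<^sub>R X u\<close>, which vanishes in the
  flat case.\<close>

lemma Z_has:
  assumes u: "u \<in> U" and "a = 0"
  shows "(Z has_derivative (\<lambda>h. 0)) (at u)"
proof -
  have V: "V u = (b * d * mu u) *\<^sub>R N u - g u *\<^sub>R e u" unfolding V_def using \<open>a = 0\<close> by simp
  show ?thesis unfolding Z_def[abs_def]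
    by (rule derivative_eq_intros f_has w_has lam_has e_has N_has u refl)+
      (simp add: fun_eq_iff f_eq[OF u] fderiv_lam[OF u] fderiv_N[OF u] fderiv_e[OF u] V \<rho>_def algebra_simps,
        simp add: \<open>a = 0\<close>)
qed

lemma eta_norm:
  assumes u: "u \<in> U" shows "B (eta u) (eta u) = d * Cf u"
\<comment> \<open>For \<open>a = 0\<close> nothing is known about the square of \<open>X\<close>,
  but its coefficient is 0; otherwise \<open>e\<close>, \<open>N\<close>, \<open>X\<close> are
  orthogonal with squares \<open>d\<close>, \<open>b\<close>, \<open>a\<close>.\<close>
proof (cases "a = 0")
  case True
  show ?thesis unfolding eta_def Cf_def
    using True e_norm[OF u] N_norm[OF u] N_e[OF u] sym[of "e u" "N u"]
    by (simp add: B.add_left B.add_right B.diff_left B.diff_right B.scaleR_left B.scaleR_right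
         B.minus_left B.minus_right power2_eq_square algebra_simps)
next
  case False
  show ?thesis unfolding eta_def Cf_def
    using False a e_norm[OF u] N_norm[OF u] N_e[OF u] sym[of "e u" "N u"] X_norm[OF False u] N_X[OF False u] X_e[OF False u]
       sym[of "e u" "X u"] sym[of "X u" "N u"]
    by (auto simp: B.add_left B.add_right B.diff_left B.diff_right B.scaleR_left B.scaleR_right
         B.minus_left B.minus_right power2_eq_square algebra_simps)
qed

end

subsection \<open>Passing between charts\<close>

lemma sform_bounded_bilinear: "bounded_bilinear (sform j)"
  unfolding bilinear_conv_bounded_bilinear[symmetric] bilinear_def
  by (auto intro!: linearI simp: sform_def algebra_simps sum.distrib sum_distrib_left)

lemma sform_sym: "sform j v w = sform j w v"
  by (simp add: sform_def mult.assoc mult.commute[of "v $ _"])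

locale immersed_manifold =
  fixes A :: "((real^'n) set \<times> (real^'n \<Rightarrow> 'm::topological_space)) set" and x :: "'m \<Rightarrow> real^'N"
  assumes atlas: "smooth_atlas A" and imm: "immersion A x"
begin

lemma
  assumes "(U, \<psi>) \<in> A"
  shows chart_open: "open U" "open (\<psi> ` U)" and chart_homeo: "\<exists>g. homeomorphism U (\<psi> ` U) \<psi> g"
    and x_smooth: "smooth_on U (x \<circ> \<psi>)"
    and x_inj: "u \<in> U \<Longrightarrow> inj (fderiv (x \<circ> \<psi>) u)"
  using assms atlas imm unfolding smooth_atlas_def immersion_def mfd_smooth_def by blast+

lemma chart_inj: "(U, \<psi>) \<in> A \<Longrightarrow> inj_on \<psi> U"
  using chart_homeo by (metis homeomorphism_def inj_on_inverseI)

lemma obtain_chart: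
  obtains U \<psi> u where "(U, \<psi>) \<in> A" "u \<in> U" "\<psi> u = p"
proof -
  have "\<exists>(U, \<psi>)\<in>A. p \<in> \<psi> ` U" using atlas unfolding smooth_atlas_def by blast
  then show thesis using that by blast
qed

text \<open>Chain rule through the smooth change of charts; it makes tangent spaces and derivatives
  independent of the chart.\<close>

lemma transition:
  assumes 1: "(U1, \<psi>1) \<in> A" "u1 \<in> U1" and 2: "(U2, \<psi>2) \<in> A" "u2 \<in> U2" and eq: "\<psi>1 u1 = \<psi>2 u2"
    and G: "(G \<circ> \<psi>2) differentiable (at u2)"
  shows "fderiv (G \<circ> \<psi>1) u1 h = fderiv (G \<circ> \<psi>2) u2 (fderiv (inv_into U2 \<psi>2 \<circ> \<psi>1) u1 h)"
proof -
  let ?T = "inv_into U2 \<psi>2 \<circ> \<psi>1" and ?W = "U1 \<inter> \<psi>1 -` (\<psi>2 ` U2)"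
  have "continuous_on U1 \<psi>1" using chart_homeo[OF 1(1)] by (auto simp: homeomorphism_def)
  then have W: "open ?W" using chart_open[OF 1(1)] chart_open[OF 2(1)] by (intro continuous_open_preimage)
  have u1: "u1 \<in> ?W" using 1 2 eq by auto
  have "smooth_on ?W ?T" using atlas 1 2 unfolding smooth_atlas_def by blast
  then have T: "(?T has_derivative fderiv ?T u1) (at u1)"
    using u1 by (intro fderiv_has smooth_on_differentiable)
  have "?T u1 = u2" using eq 2 chart_inj[OF 2(1)] by simp
  then have "((G \<circ> \<psi>2) has_derivative fderiv (G \<circ> \<psi>2) u2) (at (?T u1))"
    using fderiv_has[OF G] by (simp only:)
  then have "((\<lambda>y. (G \<circ> \<psi>2) (?T y)) has_derivative (\<lambda>h. fderiv (G \<circ> \<psi>2) u2 (fderiv ?T u1 h))) (at u1)"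
    by (rule has_derivative_compose[OF T])
  then have "((G \<circ> \<psi>1) has_derivative (\<lambda>h. fderiv (G \<circ> \<psi>2) u2 (fderiv ?T u1 h))) (at u1)"
    by (rule has_derivative_transform_within_open[OF _ W u1]) (auto simp: f_inv_into_f)
  then show ?thesis by (simp add: fderivI)
qed

lemma tspace_chart:
  assumes "(U, \<psi>) \<in> A" "u \<in> U"
  shows "tspace A x (\<psi> u) = range (fderiv (x \<circ> \<psi>) u)"
proof -
  have "v \<in> range (fderiv (x \<circ> \<psi>) u)" if "v \<in> tspace A x (\<psi> u)" for v
    using that transition[OF _ _ assms _ smooth_on_differentiable[OF x_smooth[OF assms(1)] assms(2)]]
    unfolding tspace_def by blast
  moreover have "fderiv (x \<circ> \<psi>) u h \<in> tspace A x (\<psi> u)" for h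
    using assms unfolding tspace_def by blast
  ultimately show ?thesis by blast
qed

text \<open>\<open>deriv_along\<close> chooses among candidates from all charts. Injectivity of the
  differential of \<open>x\<close> forces the parameter vectors of two charts to correspond under
  the change of charts, so all candidates agree.\<close>

lemma deriv_along_chart:
  assumes c: "(U, \<psi>) \<in> A" "u \<in> U" and G: "(G \<circ> \<psi>) differentiable (at u)"
  shows "deriv_along A x G (\<psi> u) (fderiv (x \<circ> \<psi>) u h) = fderiv (G \<circ> \<psi>) u h"
  unfolding deriv_along_def
proof (rule some_equality)
  fix y
  assume "\<exists>U1 \<psi>1 u1 h1. (U1, \<psi>1) \<in> A \<and> u1 \<in> U1 \<and> \<psi>1 u1 = \<psi> u \<and>
    fderiv (x \<circ> \<psi>1) u1 h1 = fderiv (x \<circ> \<psi>) u h \<and> y = fderiv (G \<circ> \<psi>1) u1 h1"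
  then obtain U1 \<psi>1 u1 h1 where 1: "(U1, \<psi>1) \<in> A" "u1 \<in> U1" "\<psi>1 u1 = \<psi> u"
    and xh: "fderiv (x \<circ> \<psi>1) u1 h1 = fderiv (x \<circ> \<psi>) u h" and y: "y = fderiv (G \<circ> \<psi>1) u1 h1" by blast
  have "fderiv (inv_into U \<psi> \<circ> \<psi>1) u1 h1 = h"
    using transition[OF 1(1,2) c 1(3) smooth_on_differentiable[OF x_smooth[OF c(1)] c(2)], of h1] xh
      x_inj[OF c] by (simp add: inj_eq)
  then show "y = fderiv (G \<circ> \<psi>) u h"
    using transition[OF 1(1,2) c 1(3) G, of h1] y by simp
qed (use c in blast)

text \<open>\<open>G\<close> is constant on the image of a small ball in a chart domain, and this
  image is open in the manifold; connectedness does the rest.\<close>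

lemma constant_if_fderiv_zero:
  fixes G :: "'m \<Rightarrow> 'b::real_normed_vector"
  assumes conn: "connected (UNIV :: 'm set)"
    and G: "\<And>U \<psi> u. (U, \<psi>) \<in> A \<Longrightarrow> u \<in> U \<Longrightarrow> ((G \<circ> \<psi>) has_derivative (\<lambda>h. 0)) (at u)"
  shows "G p = G q"
proof (rule connected_local_const[OF conn], simp, simp, intro ballI)
  fix p
  obtain U \<psi> u where c: "(U, \<psi>) \<in> A" "u \<in> U" "\<psi> u = p" using obtain_chart .
  obtain r where r: "r > 0" "ball u r \<subseteq> U" using chart_open[OF c(1)] c(2) open_contains_ball by blast
  obtain g where "homeomorphism U (\<psi> ` U) \<psi> g" using chart_homeo[OF c(1)] by blast
  then have "openin (top_of_set (\<psi> ` U)) (\<psi> ` ball u r)"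
    using r by (intro homeomorphism_imp_open_map) (auto intro: open_subset)
  then have "open (\<psi> ` ball u r)"
    using chart_open(2)[OF c(1)] openin_open_eq by blast
  moreover have "p \<in> \<psi> ` ball u r" using c r by auto
  moreover have "G p = G y" if y: "y \<in> \<psi> ` ball u r" for y
  proof -
    obtain v where v: "v \<in> ball u r" "y = \<psi> v" using y by blast
    have "(G \<circ> \<psi>) u = (G \<circ> \<psi>) v"
      using v r by (intro has_derivative_zero_unique_connected[of "ball u r"] G[OF c(1)]) auto
    then show ?thesis using c v by simp
  qed
  ultimately show "eventually (\<lambda>y. G p = G y) (at p within UNIV)"
    unfolding eventually_at_topological by blast
qed

end

section \<open>From charts to the whole hypersurface\<close>

theorem mainTheorem2:
  fixes At :: "((real^'n) set \<times> (real^'n \<Rightarrow> 'm::topological_space)) set"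
    and x :: "'m \<Rightarrow> (real,'N::{finite,linorder}) vec"
    and \<nu> E :: "'m \<Rightarrow> (real,'N) vec"
    and lam \<mu> w :: "'m \<Rightarrow> real"
    and \<eta> Z :: "'m \<Rightarrow> (real,'N) vec"
    and H a b d :: real and k :: nat
  assumes n3: "CARD('n) \<ge> 3"
    and a_vals: "a \<in> {-1, 0, 1}"
    and b_vals: "b \<in> {-1, 1}"
    and d_vals: "d \<in> {-1, 1}"
    and ambient_dim: "CARD('N) = (if a = 0 then CARD('n) + 1 else CARD('n) + 2)"
    and index_ok: "(if a = -1 then k + 1 else k) < CARD('N)"
    and connected_M: "connected (UNIV :: 'm set)"
    and atlas: "smooth_atlas At"
    and imm: "immersion At x"
    and in_SF: "a \<noteq> 0 \<Longrightarrow> \<forall>p. sform (if a = -1 then k + 1 else k) (x p) (x p) = a"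
    and \<nu>_smooth: "mfd_smooth At \<nu>"
    and \<nu>_tangent_SF: "a \<noteq> 0 \<Longrightarrow> \<forall>p. sform (if a = -1 then k + 1 else k) (\<nu> p) (x p) = 0"
    and \<nu>_normal: "\<forall>p. \<forall>v\<in>tspace At x p. sform (if a = -1 then k + 1 else k) (\<nu> p) v = 0"
    and \<nu>_norm: "\<forall>p. sform (if a = -1 then k + 1 else k) (\<nu> p) (\<nu> p) = b"
    and lam_smooth: "mfd_smooth At lam"
    and \<mu>_smooth: "mfd_smooth At \<mu>"
    and oriented: "\<forall>p. lam p > \<mu> p"
    and E_smooth: "mfd_smooth At E"
    and E_tangent: "\<forall>p. E p \<in> tspace At x p"
    and E_norm: "\<forall>p. sform (if a = -1 then k + 1 else k) (E p) (E p) = d"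
    and E_eigen: "\<forall>p. - deriv_along At x \<nu> p (E p) = \<mu> p *\<^sub>R E p"
    and local_frame: "\<forall>p. \<exists>U \<psi> u. (U,\<psi>) \<in> At \<and> u \<in> U \<and> \<psi> u = p \<and>
        (\<exists>e :: nat \<Rightarrow> 'm \<Rightarrow> (real,'N) vec.
           (\<forall>i < CARD('n) - 1. smooth_on U (e i \<circ> \<psi>)) \<and>
           (\<forall>q \<in> \<psi> ` U.
              (\<forall>i < CARD('n) - 1. e i q \<in> tspace At x q \<and>
                  - deriv_along At x \<nu> q (e i q) = lam q *\<^sub>R e i q \<and>
                  sform (if a = -1 then k + 1 else k) (e i q) (E q) = 0) \<and>
              (\<forall>i < CARD('n) - 1. \<forall>j < CARD('n) - 1.
                  \<bar>sform (if a = -1 then k + 1 else k) (e i q) (e j q)\<bar> = (if i = j then 1 else 0))))"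
    and cmc: "\<forall>p. (real CARD('n) - 1) * lam p + \<mu> p = real CARD('n) * H"
    and w_def: "\<forall>p. w p = (lam p - H) powr (- 1 / real CARD('n))"
    and \<eta>_def: "\<forall>p. \<eta> p = - (deriv_along At x w p (E p)) *\<^sub>R E p
                        + (d * b * lam p * w p) *\<^sub>R \<nu> p - (d * a * w p) *\<^sub>R x p"
    and Z_def: "\<forall>p. Z p = (lam p * w p) *\<^sub>R E p + (deriv_along At x w p (E p)) *\<^sub>R \<nu> p"
  shows
    "(\<forall>p. w p * deriv_along At x lam p (E p) + lam p * deriv_along At x w p (E p)
             = \<mu> p * deriv_along At x w p (E p)
          \<and> - deriv_along At x w p (E p) / w p = deriv_along At x lam p (E p) / (lam p - \<mu> p))
   \<and> (\<forall>p. \<forall>v \<in> tspace At x p. - deriv_along At x \<nu> p v = lam p *\<^sub>R v \<longrightarrow>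
          deriv_along At x E p v = (deriv_along At x w p (E p) / w p) *\<^sub>R v)
   \<and> (\<forall>p. deriv_along At x (\<lambda>q. deriv_along At x w q (E q)) p (E p)
          = - a * d * w p - b * d * w p * lam p * \<mu> p)
   \<and> (\<exists>C::real.
        (\<forall>p. (deriv_along At x w p (E p))\<^sup>2 + d * (w p)\<^sup>2 * (a + b * (lam p)\<^sup>2) = C)
      \<and> (\<forall>p. \<forall>v \<in> tspace At x p. - deriv_along At x \<nu> p v = lam p *\<^sub>R v \<longrightarrow>
            deriv_along At x \<eta> p v = (- C / w p) *\<^sub>R v)
      \<and> (\<forall>p. sform (if a = -1 then k + 1 else k) (\<eta> p) (\<eta> p) = d * C))
   \<and> (\<forall>p. deriv_along At x x p (E p) = E p
          \<and> deriv_along At x \<nu> p (E p) = - \<mu> p *\<^sub>R E p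
          \<and> deriv_along At x E p (E p) = (b * d * \<mu> p) *\<^sub>R \<nu> p - (a * d) *\<^sub>R x p)
   \<and> (\<forall>p. deriv_along At x \<eta> p (E p) = 0)
   \<and> (a = 0 \<longrightarrow> (\<exists>Z0. \<forall>p. Z p = Z0))"
proof -
  define j where "j = (if a = -1 then k + 1 else k)"
  note in_SF = in_SF[folded j_def] and \<nu>_tangent_SF = \<nu>_tangent_SF[folded j_def]
    and \<nu>_normal = \<nu>_normal[folded j_def] and \<nu>_norm = \<nu>_norm[folded j_def]
    and E_norm = E_norm[folded j_def] and local_frame = local_frame[folded j_def]
  interpret immersed_manifold At x using atlas imm by unfold_locales
  \<comment> \<open>Every chart is covered: the frame given at a point is pulled back through the
    differential of \<open>x\<close> in the chart at hand, even if the frame comes with another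
    chart.\<close>
  have chart: "\<exists>hn S. two_curvature_chart (sform j) U (x \<circ> \<psi>) (\<nu> \<circ> \<psi>) (E \<circ> \<psi>) hn S (lam \<circ> \<psi>) (\<mu> \<circ> \<psi>) a b d H"
    if c: "(U, \<psi>) \<in> At" for U \<psi>
  proof -
    have sm: "smooth_on U (\<nu> \<circ> \<psi>)" "smooth_on U (E \<circ> \<psi>)" "smooth_on U (lam \<circ> \<psi>)"
      using c \<nu>_smooth E_smooth lam_smooth unfolding mfd_smooth_def by blast+
    have ts: "tspace At x (\<psi> u) = range (fderiv (x \<circ> \<psi>) u)" if "u \<in> U" for u
      using tspace_chart[OF c that] .
    have d\<nu>: "deriv_along At x \<nu> (\<psi> u) (fderiv (x \<circ> \<psi>) u h) = fderiv (\<nu> \<circ> \<psi>) u h" if "u \<in> U" for u h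
      using deriv_along_chart[OF c that smooth_on_differentiable[OF sm(1) that]] .
    have "\<exists>h. fderiv (x \<circ> \<psi>) u h = E (\<psi> u)" if "u \<in> U" for u
      using E_tangent ts[OF that] by (metis imageE)
    then obtain hn where hn: "\<And>u. u \<in> U \<Longrightarrow> fderiv (x \<circ> \<psi>) u (hn u) = E (\<psi> u)" by metis
    have "\<exists>S. finite S \<and> card S = CARD('n) - 1 \<and> (\<forall>k\<in>S.
        fderiv (\<nu> \<circ> \<psi>) u k = - lam (\<psi> u) *\<^sub>R fderiv (x \<circ> \<psi>) u k \<and> sform j (fderiv (x \<circ> \<psi>) u k) (E (\<psi> u)) = 0
        \<and> sform j (fderiv (x \<circ> \<psi>) u k) (fderiv (x \<circ> \<psi>) u k) \<noteq> 0
        \<and> (\<forall>l\<in>S. k \<noteq> l \<longrightarrow> sform j (fderiv (x \<circ> \<psi>) u k) (fderiv (x \<circ> \<psi>) u l) = 0))" if u: "u \<in> U" for u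
    proof -
      let ?I = "{..<CARD('n) - 1}"
      let ?P = "\<lambda>e :: nat \<Rightarrow> 'm \<Rightarrow> (real,'N) vec. \<lambda>q.
              (\<forall>i < CARD('n) - 1. e i q \<in> tspace At x q \<and>
                  - deriv_along At x \<nu> q (e i q) = lam q *\<^sub>R e i q \<and> sform j (e i q) (E q) = 0) \<and>
              (\<forall>i < CARD('n) - 1. \<forall>l < CARD('n) - 1.
                  \<bar>sform j (e i q) (e l q)\<bar> = (if i = l then 1 else 0))"
      obtain U' :: "(real^'n) set" and \<psi>' u' e where "u' \<in> U'" "\<psi>' u' = \<psi> u" "\<forall>q \<in> \<psi>' ` U'. ?P e q"
        using local_frame[THEN spec, of "\<psi> u"] by (elim exE conjE) (rule that; assumption)
      then have "?P e (\<psi> u)" by (metis imageI)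
      then have
        e: "\<And>i. i \<in> ?I \<Longrightarrow> e i (\<psi> u) \<in> tspace At x (\<psi> u) \<and>
              - deriv_along At x \<nu> (\<psi> u) (e i (\<psi> u)) = lam (\<psi> u) *\<^sub>R e i (\<psi> u) \<and> sform j (e i (\<psi> u)) (E (\<psi> u)) = 0"
        and on: "\<And>i l. i \<in> ?I \<Longrightarrow> l \<in> ?I \<Longrightarrow> \<bar>sform j (e i (\<psi> u)) (e l (\<psi> u))\<bar> = (if i = l then 1 else 0)"
        by simp_all
      have "\<forall>i\<in>?I. \<exists>h. fderiv (x \<circ> \<psi>) u h = e i (\<psi> u)"
        using e ts[OF u] by (metis imageE)
      then obtain h where h: "\<And>i. i \<in> ?I \<Longrightarrow> fderiv (x \<circ> \<psi>) u (h i) = e i (\<psi> u)" by metis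
      \<comment> \<open>Equal parameter vectors for \<open>i \<noteq> l\<close> would give a product
        with absolute value both 0 and 1; so \<open>h\<close> maps onto exactly n-1 vectors.\<close>
      have inj: "inj_on h ?I"
      proof (rule inj_onI)
        fix i l assume "i \<in> ?I" "l \<in> ?I" "h i = h l"
        then show "i = l" using on[of i l] on[of i i] h by (metis zero_neq_one)
      qed
      show ?thesis
      proof (intro exI[of _ "h ` ?I"] conjI ballI impI)
        fix k assume "k \<in> h ` ?I"
        then obtain i where i: "i \<in> ?I" "k = h i" by blast
        show "fderiv (\<nu> \<circ> \<psi>) u k = - lam (\<psi> u) *\<^sub>R fderiv (x \<circ> \<psi>) u k"
          using e[OF i(1)] h[OF i(1)] d\<nu>[OF u, of k] i(2) by (metis minus_minus scaleR_minus_left)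
        show "sform j (fderiv (x \<circ> \<psi>) u k) (E (\<psi> u)) = 0" using e[OF i(1)] h[OF i(1)] i by simp
        show "sform j (fderiv (x \<circ> \<psi>) u k) (fderiv (x \<circ> \<psi>) u k) \<noteq> 0" using on[OF i(1) i(1)] h[OF i(1)] i by auto
        fix l assume "l \<in> h ` ?I" "k \<noteq> l"
        then obtain m where m: "m \<in> ?I" "l = h m" "m \<noteq> i" using i by blast
        then show "sform j (fderiv (x \<circ> \<psi>) u k) (fderiv (x \<circ> \<psi>) u l) = 0"
          using on[OF i(1) m(1)] h[OF i(1)] h[OF m(1)] i by simp
      qed (use card_image[OF inj] in simp_all)
    qed
    then obtain S where S: "\<And>u. u \<in> U \<Longrightarrow> finite (S u) \<and> card (S u) = CARD('n) - 1 \<and> (\<forall>k\<in>S u.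
        fderiv (\<nu> \<circ> \<psi>) u k = - lam (\<psi> u) *\<^sub>R fderiv (x \<circ> \<psi>) u k \<and> sform j (fderiv (x \<circ> \<psi>) u k) (E (\<psi> u)) = 0
        \<and> sform j (fderiv (x \<circ> \<psi>) u k) (fderiv (x \<circ> \<psi>) u k) \<noteq> 0
        \<and> (\<forall>l\<in>S u. k \<noteq> l \<longrightarrow> sform j (fderiv (x \<circ> \<psi>) u k) (fderiv (x \<circ> \<psi>) u l) = 0))"
      by metis
    have \<nu>E: "fderiv (\<nu> \<circ> \<psi>) u (hn u) = - \<mu> (\<psi> u) *\<^sub>R E (\<psi> u)" if "u \<in> U" for u
      using E_eigen d\<nu>[OF that, of "hn u"] hn[OF that] by (metis minus_minus scaleR_minus_left)
    have "two_curvature_chart (sform j) U (x \<circ> \<psi>) (\<nu> \<circ> \<psi>) (E \<circ> \<psi>) hn S (lam \<circ> \<psi>) (\<mu> \<circ> \<psi>) a b d H"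
    proof (intro two_curvature_chart.intro)
      show "sform j v v' = sform j v' v" for v v' :: "(real,'N) vec" by (rule sform_sym)
      fix u h assume u: "u \<in> U"
      show "sform j ((\<nu> \<circ> \<psi>) u) (fderiv (x \<circ> \<psi>) u h) = 0" using \<nu>_normal ts[OF u] by simp
      show "a \<noteq> 0 \<Longrightarrow> sform j ((x \<circ> \<psi>) u) ((x \<circ> \<psi>) u) = a" using in_SF by simp
      show "a \<noteq> 0 \<Longrightarrow> sform j ((\<nu> \<circ> \<psi>) u) ((x \<circ> \<psi>) u) = 0" using \<nu>_tangent_SF by simp
    qed (use sm n3 a_vals b_vals d_vals in \<open>simp_all add: sform_bounded_bilinear chart_open[OF c] x_smooth[OF c]
          ambient_dim \<nu>_norm E_norm hn \<nu>E S oriented cmc\<close>)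
    then show ?thesis by blast
  qed

  define F where "F q = deriv_along At x w q (E q)" for q
  define Cf where "Cf q = (F q)\<^sup>2 + d * (w q)\<^sup>2 * (a + b * (lam q)\<^sup>2)" for q
  \<comment> \<open>The last two conjuncts stay in chart form, as
    \<open>constant_if_fderiv_zero\<close> takes them.\<close>
  have pointwise: "w p * deriv_along At x lam p (E p) + lam p * F p = \<mu> p * F p
      \<and> - F p / w p = deriv_along At x lam p (E p) / (lam p - \<mu> p)
      \<and> (\<forall>v \<in> tspace At x p. - deriv_along At x \<nu> p v = lam p *\<^sub>R v \<longrightarrow>
          deriv_along At x E p v = (F p / w p) *\<^sub>R v \<and> deriv_along At x \<eta> p v = (- Cf p / w p) *\<^sub>R v)
      \<and> deriv_along At x F p (E p) = - a * d * w p - b * d * w p * lam p * \<mu> p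
      \<and> sform j (\<eta> p) (\<eta> p) = d * Cf p
      \<and> deriv_along At x x p (E p) = E p \<and> deriv_along At x \<nu> p (E p) = - \<mu> p *\<^sub>R E p
      \<and> deriv_along At x E p (E p) = (b * d * \<mu> p) *\<^sub>R \<nu> p - (a * d) *\<^sub>R x p
      \<and> deriv_along At x \<eta> p (E p) = 0
      \<and> ((Cf \<circ> \<psi>) has_derivative (\<lambda>h. 0)) (at u)
      \<and> (a = 0 \<longrightarrow> ((Z \<circ> \<psi>) has_derivative (\<lambda>h. 0)) (at u))"
    if c: "(U, \<psi>) \<in> At" and u: "u \<in> U" and p: "p = \<psi> u" for U \<psi> u p
  proof -
    obtain hn S where tc: "two_curvature_chart (sform j) U (x \<circ> \<psi>) (\<nu> \<circ> \<psi>) (E \<circ> \<psi>) hn S (lam \<circ> \<psi>) (\<mu> \<circ> \<psi>) a b d H"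
      using chart[OF c] by blast
    interpret C: two_curvature_chart "sform j" U "x \<circ> \<psi>" "\<nu> \<circ> \<psi>" "E \<circ> \<psi>" hn S "lam \<circ> \<psi>" "\<mu> \<circ> \<psi>" a b d H
      by (rule tc)
    \<comment> \<open>The global functions match those of the chart locale on \<open>U\<close>;
      openness of \<open>U\<close> carries the derivatives over.\<close>
    note transform = has_derivative_transform_within_open[OF _ C.U u]
    have E: "E (\<psi> y) = fderiv (x \<circ> \<psi>) y (hn y)" if "y \<in> U" for y using C.hn[OF that] by simp
    have w: "w \<circ> \<psi> = C.w" by (simp add: fun_eq_iff w_def C.w_def)
    have F: "F (\<psi> y) = C.f y" if "y \<in> U" for y
      unfolding F_def E[OF that] C.f_def w[symmetric]
      by (rule deriv_along_chart[OF c that]) (use C.w_has[OF that] in \<open>auto simp: w intro: differentiableI\<close>)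
    have \<eta>: "\<eta> (\<psi> y) = C.eta y" if "y \<in> U" for y
      using \<eta>_def F[OF that] w[THEN fun_cong, of y] by (simp add: F_def C.eta_def)
    have Z: "Z (\<psi> y) = C.Z y" if "y \<in> U" for y
      using Z_def F[OF that] w[THEN fun_cong, of y] by (simp add: F_def C.Z_def)
    have Cf: "Cf (\<psi> y) = C.Cf y" if "y \<in> U" for y
      using F[OF that] w[THEN fun_cong, of y] by (simp add: Cf_def C.Cf_def)
    have F_has: "((F \<circ> \<psi>) has_derivative (\<lambda>h. - C.\<theta> u h * C.w u * (b * d * (\<mu> \<circ> \<psi>) u * (lam \<circ> \<psi>) u + a * d))) (at u)"
      by (rule transform[OF C.f_has[OF u]]) (simp add: F)
    have \<eta>_has: "((\<eta> \<circ> \<psi>) has_derivative (\<lambda>h. - (C.Cf u / C.w u) *\<^sub>R (fderiv (x \<circ> \<psi>) u h - C.\<theta> u h *\<^sub>R (E \<circ> \<psi>) u))) (at u)"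
      by (rule transform[OF C.eta_has[OF u]]) (simp add: \<eta>)
    have Cf_has: "((Cf \<circ> \<psi>) has_derivative (\<lambda>h. 0)) (at u)"
      by (rule transform[OF C.Cf_has[OF u]]) (simp add: Cf)
    have Z_has: "((Z \<circ> \<psi>) has_derivative (\<lambda>h. 0)) (at u)" if "a = 0"
      by (rule transform[OF C.Z_has[OF u that]]) (simp add: Z)
    have along: "deriv_along At x G p (fderiv (x \<circ> \<psi>) u h) = G' h"
      if "((G \<circ> \<psi>) has_derivative G') (at u)" for G :: "'m \<Rightarrow> 'c::real_normed_vector" and G' h
      using deriv_along_chart[OF c u differentiableI[OF that], of h] fderivI[OF that] by (simp add: p)
    have alongE: "deriv_along At x G p (E p) = G' (hn u)"
      if "((G \<circ> \<psi>) has_derivative G') (at u)" for G :: "'m \<Rightarrow> 'c::real_normed_vector" and G'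
      using along[OF that] E[OF u] p by simp
    have at_p: "(x \<circ> \<psi>) u = x p" "(\<nu> \<circ> \<psi>) u = \<nu> p" "(E \<circ> \<psi>) u = E p" "(lam \<circ> \<psi>) u = lam p"
      "(\<mu> \<circ> \<psi>) u = \<mu> p" "C.w u = w p" "C.f u = F p" "C.Cf u = Cf p" "C.eta u = \<eta> p"
      using F[OF u] Cf[OF u] \<eta>[OF u] by (simp_all add: p flip: w)
    have lam_pos: "lam p - \<mu> p > 0" and w_pos: "w p > 0"
      using oriented C.w_pos[OF u] by (simp_all add: at_p)
    have F_p: "F p = C.g u * w p" using C.f_eq[OF u] by (simp add: at_p)
    have lamE: "deriv_along At x lam p (E p) = - (lam p - \<mu> p) * C.g u"
      using alongE[OF C.lam_has[OF u]] C.fderiv_lam[OF u] by (simp add: C.\<theta>_hn[OF u] C.\<rho>_def p)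
    \<comment> \<open>A vector of \<Gamma> has a parameter with \<open>\<theta>\<close> equal to 0,
      which removes the \<open>V\<close>-term for \<open>E\<close> and the \<open>e\<close>-term for
      \<open>\<eta>\<close>.\<close>
    have eigen: "deriv_along At x E p v = (F p / w p) *\<^sub>R v \<and> deriv_along At x \<eta> p v = (- Cf p / w p) *\<^sub>R v"
      if v: "v \<in> tspace At x p" "- deriv_along At x \<nu> p v = lam p *\<^sub>R v" for v
    proof -
      obtain h where h: "v = fderiv (x \<circ> \<psi>) u h" using v(1) tspace_chart[OF c u] p by blast
      have "fderiv (\<nu> \<circ> \<psi>) u h = - lam p *\<^sub>R fderiv (x \<circ> \<psi>) u h"
        using v(2) along[OF C.N_has[OF u], of h] h by (metis minus_minus scaleR_minus_left)
      then have \<theta>: "C.\<theta> u h = 0" by (intro C.\<theta>_eq_0_if_eigenvector[OF u]) (simp add: p)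
      have "deriv_along At x E p v = C.g u *\<^sub>R v"
        using along[OF C.e_has[OF u], of h] C.fderiv_e[OF u, of h] by (simp add: h \<theta>)
      moreover have "deriv_along At x \<eta> p v = (- Cf p / w p) *\<^sub>R v"
        using along[OF \<eta>_has, of h] by (simp add: h \<theta> at_p)
      ultimately show ?thesis using w_pos by (simp add: F_p)
    qed
    have "w p * deriv_along At x lam p (E p) + lam p * F p = \<mu> p * F p"
      by (simp add: lamE F_p algebra_simps)
    moreover have "- F p / w p = deriv_along At x lam p (E p) / (lam p - \<mu> p)"
      using lam_pos w_pos by (simp add: lamE F_p eq_divide_eq algebra_simps)
    moreover have "deriv_along At x F p (E p) = - a * d * w p - b * d * w p * lam p * \<mu> p"
      using alongE[OF F_has] by (simp add: C.\<theta>_hn[OF u] at_p p algebra_simps)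
    moreover have "sform j (\<eta> p) (\<eta> p) = d * Cf p"
      using C.eta_norm[OF u] by (simp add: at_p p)
    moreover have "deriv_along At x x p (E p) = E p" "deriv_along At x \<nu> p (E p) = - \<mu> p *\<^sub>R E p"
      using alongE[OF C.X_has[OF u]] alongE[OF C.N_has[OF u]] C.hn[OF u] C.N_hn[OF u] by (simp_all add: at_p p)
    moreover have "deriv_along At x E p (E p) = (b * d * \<mu> p) *\<^sub>R \<nu> p - (a * d) *\<^sub>R x p"
      using alongE[OF C.e_has[OF u]] C.fderiv_e_hn[OF u] by (simp add: at_p p)
    moreover have "deriv_along At x \<eta> p (E p) = 0"
      using alongE[OF \<eta>_has] C.hn[OF u] by (simp add: C.\<theta>_hn[OF u] at_p p)
    ultimately show ?thesis using eigen Cf_has Z_has by blast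
  qed
  have charted: "\<exists>U \<psi> u. (U, \<psi>) \<in> At \<and> u \<in> U \<and> p = \<psi> u" for p
    using obtain_chart by metis
  have "Cf p = Cf q" for p q
    by (rule constant_if_fderiv_zero[OF connected_M]) (use pointwise in blast)
  then obtain C where C: "\<And>p. Cf p = C" by metis
  have "Z p = Z q" if "a = 0" for p q
    by (rule constant_if_fderiv_zero[OF connected_M]) (use pointwise that in blast)
  then have Z: "a = 0 \<longrightarrow> (\<exists>Z0. \<forall>p. Z p = Z0)" by metis
  \<comment> \<open>The same \<open>C\<close> serves the first integral, the derivative of
    \<open>\<eta>\<close> along \<Gamma> and the square of \<open>\<eta>\<close>.\<close>
  show ?thesis
    unfolding F_def[symmetric] j_def[symmetric]
    using charted pointwise[unfolded C] C[unfolded Cf_def] Z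
    by (intro conjI allI exI[of _ C] ballI impI) blast+
qed

end
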